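(* Let $G$ be a (non-empty) planar graph without loops or multiple edges which has a plane representation with no vertex accumulation points. Suppose that: (1) there exist real numbers $K$ and $D$ such that for every vertex $v$ of $G$ and every real $r\geq 1$ the number of vertices in the open ball $B(v,r)$ satisfies $|B(v,r)|\leq K r^{D}$; and (2) there exist real numbers $k,\epsilon>0$ such that for every finite non-empty set $S$ of vertices of $G$ one has $|\partial S|\geq k|S|^{\epsilon}$. Let $p_c$ be the critical $p$ for independent (Bernoulli) bond percolation on $G$. Then $p_c<1$.
   Context: A plane representation of a graph $G$ is a drawing of $G$ in $\mathbb{R}^2$ in which vertices are distinct points, each edge is a simple arc joining its two endpoints, and edges meet each other and the vertices only at common endpoints; $G$ is planar if it has such a representation. A vertex accumulation point of a plane representation is a point $x\in\mathbb{R}^2$ such that every neighborhood of $x$ contains infinitely many vertices. $B(v,r)$ denotes the open ball, i.e. the set of vertices at graph distance strictly less than $r$ from $v$ in $G$. For a set $S$ of vertices, $\partial S$ is the set of edges of $G$ with one endpoint in $S$ and the other endpoint not in $S$. In independent bond percolation with parameter $p\in[0,1]$ each edge of $G$ is kept (open) with probability $p$ and removed with probability $1-p$, independently of all other edges. A cluster is a connected component of the graph formed by all the vertices and the open edges. The critical value is $p_c=\sup\{p\in[0,1] : \mathbb{P}_p(\text{there exists an infinite cluster})=0\}$. *)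

theory Defs
  imports "HOL-Probability.Probability"
begin

text \<open>A graph is given by a vertex set \<open>V\<close> and a set \<open>E\<close> of edges, where an edge is the set of its
  two endpoints; so loops and multiple edges are excluded. Neither set is assumed to be finite.\<close>

definition simple_graph :: "'a set \<Rightarrow> 'a set set \<Rightarrow> bool" where
  "simple_graph V E \<longleftrightarrow> (\<forall>e\<in>E. \<exists>u\<in>V. \<exists>v\<in>V. u \<noteq> v \<and> e = {u, v})"

definition adj :: "'a set set \<Rightarrow> ('a \<times> 'a) set" where
  "adj E = {(u, v). {u, v} \<in> E}"

text \<open>The distance of vertices in different components is \<open>\<infinity>\<close>, the infimum of the empty set.\<close>

definition graph_dist :: "'a set set \<Rightarrow> 'a \<Rightarrow> 'a \<Rightarrow> enat" where
  "graph_dist E u v = (INF n\<in>{n. (u, v) \<in> adj E ^^ n}. enat n)"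

definition graph_ball :: "'a set \<Rightarrow> 'a set set \<Rightarrow> 'a \<Rightarrow> real \<Rightarrow> 'a set" where
  "graph_ball V E v r = {w \<in> V. ereal_of_enat (graph_dist E v w) < ereal r}"

definition edge_boundary :: "'a set \<Rightarrow> 'a set set \<Rightarrow> 'a set \<Rightarrow> 'a set set" where
  "edge_boundary V E S = {e \<in> E. \<exists>u\<in>S. \<exists>v\<in>V - S. e = {u, v}}"

definition plane_representation ::
    "'a set \<Rightarrow> 'a set set \<Rightarrow> ('a \<Rightarrow> real ^ 2) \<Rightarrow> ('a set \<Rightarrow> real \<Rightarrow> real ^ 2) \<Rightarrow> bool" where
  "plane_representation V E \<phi> \<gamma> \<longleftrightarrow>
     inj_on \<phi> V \<and>
     (\<forall>e\<in>E. arc (\<gamma> e) \<and> {pathstart (\<gamma> e), pathfinish (\<gamma> e)} = \<phi> ` e) \<and>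
     (\<forall>e\<in>E. \<forall>v\<in>V. \<phi> v \<in> path_image (\<gamma> e) \<longrightarrow> v \<in> e) \<and>
     (\<forall>e\<in>E. \<forall>f\<in>E. e \<noteq> f \<longrightarrow> path_image (\<gamma> e) \<inter> path_image (\<gamma> f) \<subseteq> \<phi> ` (e \<inter> f))"

definition planar :: "'a set \<Rightarrow> 'a set set \<Rightarrow> bool" where
  "planar V E \<longleftrightarrow> (\<exists>\<phi> \<gamma>. plane_representation V E \<phi> \<gamma>)"

definition vertex_accumulation_point :: "'a set \<Rightarrow> ('a \<Rightarrow> real ^ 2) \<Rightarrow> real ^ 2 \<Rightarrow> bool" where
  "vertex_accumulation_point V \<phi> x \<longleftrightarrow>
     (\<forall>U. open U \<and> x \<in> U \<longrightarrow> infinite {v \<in> V. \<phi> v \<in> U})"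

definition percolation :: "'a set set \<Rightarrow> real \<Rightarrow> ('a set \<Rightarrow> bool) measure" where
  "percolation E p = Pi\<^sub>M E (\<lambda>_. measure_pmf (bernoulli_pmf p))"

definition open_edges :: "'a set set \<Rightarrow> ('a set \<Rightarrow> bool) \<Rightarrow> 'a set set" where
  "open_edges E \<omega> = {e \<in> E. \<omega> e}"

definition cluster :: "'a set \<Rightarrow> 'a set set \<Rightarrow> ('a set \<Rightarrow> bool) \<Rightarrow> 'a \<Rightarrow> 'a set" where
  "cluster V E \<omega> v = {w \<in> V. (v, w) \<in> (adj (open_edges E \<omega>))\<^sup>*}"

text \<open>The event below is measurable when \<open>V\<close> is countable, which is automatic for a graph having
  a plane representation without vertex accumulation points.\<close>

definition infinite_cluster_event :: "'a set \<Rightarrow> 'a set set \<Rightarrow> ('a set \<Rightarrow> bool) set" where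
  "infinite_cluster_event V E =
     {\<omega> \<in> (\<Pi>\<^sub>E e\<in>E. UNIV). \<exists>v\<in>V. infinite (cluster V E \<omega> v)}"

definition critical_prob :: "'a set \<Rightarrow> 'a set set \<Rightarrow> real" where
  "critical_prob V E =
     Sup {p \<in> {0..1}. measure (percolation E p) (infinite_cluster_event V E) = 0}"

end

theory Submission
  imports Defs
begin

text \<open>
  The theorem is proved by Peierls' argument. If the cluster of a vertex \<open>v\<close> is finite, then all
  edges of some bond, i.e. minimal cut, around \<open>v\<close> are closed
  (\<open>closed_bond_around_finite_cluster\<close>). So it suffices that the number of bonds of size \<open>m\<close> around
  \<open>v\<close> is at most \<open>L ^ m\<close> for some \<open>L\<close> (\<open>card_bonds_le\<close>): for \<open>p\<close> close to 1 the probability that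
  some bond around \<open>v\<close> is closed is then less than 1.

  In the plane a bond is a closed curve in the dual graph. The faces are unbounded in size, so a
  dual curve can continue in arbitrarily many ways at every step and the usual count fails. What
  helps is rigidity: two dual paths of length \<open>n\<close> with the same ends form a closed curve of length
  at most \<open>2 * n\<close>, which by the isoperimetric inequality encloses only polynomially many vertices.
  Hence the two paths are close to each other (\<open>dual_paths_nearby\<close>), and by polynomial growth all
  dual paths of length \<open>n\<close> with given ends run through polynomially many edges. In particular there
  are polynomially many choices for the midpoint of such a path, and repeated halving
  (\<open>card_dual_paths_le\<close>) shows that their number is at most exponential in \<open>n\<close>. A bond without one
  of its edges is a dual path with given ends.

  Planarity is used only through the existence of an abstract dual: two faces for each edge such
  that a finite edge set is the boundary of a finite vertex set iff it has even degree at every face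
  (\<open>boundary_dual\<close>). Then closed curves, paths and their halves are dealt with by linear algebra
  modulo 2. The dual is constructed for finite parts of the graph. Their complement is contracted to
  a vertex at infinity, which is possible in the plane because no vertices accumulate. The drawing
  is then replaced by pixels, so that the finite graph becomes a minor of the square grid; there
  the dual is explicit (\<open>grid_dual\<close>), and minors inherit it (\<open>grid_minor_dual\<close>).
\<close>

section \<open>Parity of edge sets at faces\<close>

text \<open>Throughout, \<open>l e\<close> and \<open>r e\<close> are the faces on the two sides of an edge \<open>e\<close>, so that \<open>l\<close> and \<open>r\<close>
  describe a dual graph. The edge counts twice at \<open>f\<close> if \<open>f\<close> lies on both of its sides: such an
  edge is a loop of the dual graph, hence even, and correspondingly a bridge is a cut by itself.\<close>

definition face_degree :: "('e \<Rightarrow> 'f) \<Rightarrow> ('e \<Rightarrow> 'f) \<Rightarrow> 'e set \<Rightarrow> 'f \<Rightarrow> nat" where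
  "face_degree l r P f = (\<Sum>e\<in>P. of_bool (l e = f) + of_bool (r e = f))"

text \<open>An edge set without odd faces is an element of the cycle space of the dual graph. Planar duality
  is used only in the form that these edge sets are exactly the cuts.\<close>

definition odd_faces :: "('e \<Rightarrow> 'f) \<Rightarrow> ('e \<Rightarrow> 'f) \<Rightarrow> 'e set \<Rightarrow> 'f set" where
  "odd_faces l r P = {f. odd (face_degree l r P f)}"

lemma odd_faces_empty [simp]: "odd_faces l r {} = {}"
  by (simp add: odd_faces_def face_degree_def)

lemma odd_faces_singleton: "odd_faces l r {e} = sym_diff {l e} {r e}"
  by (auto simp: odd_faces_def face_degree_def)

lemma face_degree_Un:
  "finite P \<Longrightarrow> finite Q \<Longrightarrow> P \<inter> Q = {} \<Longrightarrow>
    face_degree l r (P \<union> Q) f = face_degree l r P f + face_degree l r Q f"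
  unfolding face_degree_def by (rule sum.union_disjoint)

lemma odd_faces_Un:
  assumes "finite P" "finite Q" "P \<inter> Q = {}"
  shows "odd_faces l r (P \<union> Q) = sym_diff (odd_faces l r P) (odd_faces l r Q)"
  by (auto simp: odd_faces_def face_degree_Un[OF assms])

lemma odd_faces_sym_diff:
  assumes "finite P" "finite Q"
  shows "odd_faces l r (sym_diff P Q) = sym_diff (odd_faces l r P) (odd_faces l r Q)"
proof -
  have 1: "odd_faces l r P = sym_diff (odd_faces l r (P - Q)) (odd_faces l r (P \<inter> Q))"
    using odd_faces_Un[of "P - Q" "P \<inter> Q" l r] assms by (simp add: Un_Diff_Int disjoint_iff)
  have 2: "odd_faces l r Q = sym_diff (odd_faces l r (Q - P)) (odd_faces l r (P \<inter> Q))"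
    using odd_faces_Un[of "Q - P" "Q \<inter> P" l r] assms
    by (simp add: Un_Diff_Int disjoint_iff Int_commute[of P])
  have 3: "odd_faces l r (sym_diff P Q) = sym_diff (odd_faces l r (P - Q)) (odd_faces l r (Q - P))"
    using odd_faces_Un[of "P - Q" "Q - P" l r] assms by blast
  show ?thesis unfolding 3 1 2 by blast
qed

lemma odd_faces_insert:
  assumes "finite P" "d \<notin> P"
  shows "odd_faces l r (insert d P) = sym_diff (odd_faces l r P) (sym_diff {l d} {r d})"
  using odd_faces_Un[of P "{d}" l r] assms by (simp add: odd_faces_singleton)

lemma odd_faces_incident:
  assumes "f \<in> odd_faces l r P"
  shows "\<exists>e\<in>P. l e \<noteq> r e \<and> (l e = f \<or> r e = f)"
proof (rule ccontr)
  assume "\<not> ?thesis"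
  then have "\<forall>e\<in>P. even (of_bool (l e = f) + of_bool (r e = f) :: nat)" by auto
  then have "even (face_degree l r P f)" unfolding face_degree_def by (intro dvd_sum) auto
  with assms show False by (simp add: odd_faces_def)
qed

definition edge_cut :: "('e \<Rightarrow> 'v) \<Rightarrow> ('e \<Rightarrow> 'v) \<Rightarrow> 'v set \<Rightarrow> 'e set" where
  "edge_cut a b T = {e. (a e \<in> T) \<noteq> (b e \<in> T)}"

section \<open>Deletion and duality\<close>

text \<open>Deleting an edge contracts it in the dual graph, so the two faces along it become one. If \<open>P\<close> is
  even after this merger of the faces of \<open>d\<close>, then it was even before or odd exactly at these two
  faces; in the latter case \<open>insert d P\<close> was even. So the even sets after deletion of \<open>Y\<close> are
  precisely the traces \<open>Q - Y\<close> of the even sets. Contraction needs no lemma: it only restricts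
  attention to the sets \<open>Q\<close> that avoid the contracted edges.\<close>

lemma dual_of_deletion:
  fixes l r :: "'e \<Rightarrow> 'f"
  assumes "finite Y"
    and "\<And>P. finite P \<Longrightarrow> P \<in> \<C> \<longleftrightarrow> odd_faces l r P = {}"
  shows "\<exists>l' r' :: 'e \<Rightarrow> 'f. \<forall>P. finite P \<longrightarrow> P \<inter> Y = {} \<longrightarrow>
           ((\<exists>Q\<in>\<C>. finite Q \<and> Q - Y = P) \<longleftrightarrow> odd_faces l' r' P = {})"
  using assms(1)
proof (induction Y rule: finite_induct)
  case empty
  show ?case using assms(2) by (intro exI[of _ l] exI[of _ r]) auto
next
  case (insert d Y)
  then obtain l r :: "'e \<Rightarrow> 'f" where IH0: "\<forall>P. finite P \<longrightarrow> P \<inter> Y = {} \<longrightarrow>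
      ((\<exists>Q\<in>\<C>. finite Q \<and> Q - Y = P) \<longleftrightarrow> odd_faces l r P = {})"
    by (elim exE that)
  note IH = IH0[rule_format]
  \<comment> \<open>the face \<open>r d\<close> is merged into \<open>l d\<close>\<close>
  define m where "m x = (if x = r d then l d else x)" for x
  have merge: "face_degree (m \<circ> l) (m \<circ> r) P f =
      (if f = l d then if l d = r d then face_degree l r P f
          else face_degree l r P (l d) + face_degree l r P (r d)
       else if f = r d then 0 else face_degree l r P f)" for P f
    by (auto simp: face_degree_def m_def sum.distrib[symmetric] intro!: sum.cong sum.neutral)
  have md: "m (l d) = m (r d)" by (simp add: m_def)
  show ?case
  proof (intro exI allI impI iffI)
    fix P assume P: "finite P" "P \<inter> insert d Y = {}"
    { assume "\<exists>Q\<in>\<C>. finite Q \<and> Q - insert d Y = P"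
      then obtain Q where Q: "Q \<in> \<C>" "finite Q" "Q - insert d Y = P" by blast
      have "odd_faces l r (Q - Y) = {}"
        using IH[of "Q - Y"] Q by blast
      then have e: "odd_faces (m \<circ> l) (m \<circ> r) (Q - Y) = {}"
        by (auto simp: odd_faces_def merge)
      show "odd_faces (m \<circ> l) (m \<circ> r) P = {}"
      proof (cases "d \<in> Q")
        case True
        then have "Q - Y = insert d P" using Q(3) insert.hyps by blast
        then show ?thesis using e P odd_faces_insert[of P d "m \<circ> l" "m \<circ> r"] md by auto
      next
        case False
        then have "Q - Y = P" using Q(3) by blast
        then show ?thesis using e by simp
      qed }
    { assume e: "odd_faces (m \<circ> l) (m \<circ> r) P = {}"
      have e1: "even (face_degree (m \<circ> l) (m \<circ> r) P f)" for f
        using e by (auto simp: odd_faces_def)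
      have sub: "odd_faces l r P \<subseteq> {l d, r d}"
      proof
        fix f assume "f \<in> odd_faces l r P"
        then show "f \<in> {l d, r d}"
          using e1[of f] by (auto simp: odd_faces_def merge split: if_splits)
      qed
      have both: "l d \<in> odd_faces l r P \<longleftrightarrow> r d \<in> odd_faces l r P"
        using e1[of "l d"] by (auto simp: odd_faces_def merge split: if_splits)
      show "\<exists>Q\<in>\<C>. finite Q \<and> Q - insert d Y = P"
      proof (cases "l d \<in> odd_faces l r P")
        case False
        then have "odd_faces l r P = {}" using sub both by blast
        then obtain Q where "Q \<in> \<C>" "finite Q" "Q - Y = P" using IH[of P] P by blast
        then show ?thesis using P by (intro bexI[of _ Q]) auto
      next
        case True
        have "l d \<noteq> r d" using e1[of "l d"] True by (auto simp: odd_faces_def merge)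
        moreover have "odd_faces l r P = {l d, r d}" using sub both True by (intro equalityI) simp_all
        ultimately have "odd_faces l r (insert d P) = {}"
          using odd_faces_insert[of P d l r] P by auto
        moreover have "insert d P \<inter> Y = {}" using P insert.hyps by blast
        ultimately obtain Q where "Q \<in> \<C>" "finite Q" "Q - Y = insert d P"
          using IH[of "insert d P"] P by blast
        then show ?thesis using P by (intro bexI[of _ Q]) auto
      qed }
  qed
qed

section \<open>Minors of the square grid\<close>

text \<open>The edge \<open>((i, j), b)\<close> leads from \<open>(i, j)\<close> to the right if \<open>b\<close> and upwards otherwise. The faces
  are the unit squares, named after their lower left corner; hence \<open>fst\<close> is at the same time the
  lower or left end of an edge and the face above or to the right of it.\<close>

type_synonym grid_edge = "(int \<times> int) \<times> bool"

fun grid_end :: "grid_edge \<Rightarrow> int \<times> int" where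
  "grid_end ((i, j), b) = (if b then (i + 1, j) else (i, j + 1))"

fun grid_other_face :: "grid_edge \<Rightarrow> int \<times> int" where
  "grid_other_face ((i, j), b) = (if b then (i, j - 1) else (i - 1, j))"

lemma grid_odd_face:
  assumes "finite P"
  shows "(i, j) \<in> odd_faces fst grid_other_face P \<longleftrightarrow>
    (((((i, j), True) \<in> P) \<noteq> (((i, j), False) \<in> P)) \<noteq>
     ((((i, j + 1), True) \<in> P) \<noteq> (((i + 1, j), False) \<in> P)))"
proof -
  let ?S = "{((i, j), True), ((i, j), False), ((i, j + 1), True), ((i + 1, j), False)}"
  have r: "grid_other_face e = (i, j) \<longleftrightarrow> e = ((i, j + 1), True) \<or> e = ((i + 1, j), False)" for e
    by (cases e rule: grid_other_face.cases) auto
  have s: "fst e = (i, j) \<longleftrightarrow> e = ((i, j), True) \<or> e = ((i, j), False)" for e :: grid_edge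
    by (cases e rule: grid_other_face.cases) auto
  have "face_degree fst grid_other_face P (i, j) =
      (\<Sum>e\<in>P \<inter> ?S. of_bool (fst e = (i, j)) + of_bool (grid_other_face e = (i, j)))"
    unfolding face_degree_def by (rule sum.mono_neutral_right) (use assms r s in auto)
  also have "\<dots> = (\<Sum>e\<in>?S. if e \<in> P then of_bool (fst e = (i, j)) + of_bool (grid_other_face e = (i, j)) else 0)"
    by (subst Int_commute) (rule sum.inter_restrict, simp)
  also have "\<dots> = of_bool (((i, j), True) \<in> P) + of_bool (((i, j), False) \<in> P) +
     (of_bool (((i, j + 1), True) \<in> P) + of_bool (((i + 1, j), False) \<in> P))"
    by (simp add: if_distrib)
  finally show ?thesis by (simp add: odd_faces_def)
qed

text \<open>Conversely to the obvious direction, colour \<open>(x, y)\<close> by the parity of the number of edges of \<open>P\<close>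
  on the horizontal ray to its right. A horizontal edge then changes the colour iff it is in \<open>P\<close>.
  For a vertical edge, evenness of the squares to its right moves the claim from \<open>x\<close> to \<open>x + 1\<close>,
  and far to the right it holds since \<open>P\<close> is finite.\<close>

lemma grid_dual:
  assumes "finite P"
  shows "P \<in> range (edge_cut fst grid_end) \<longleftrightarrow> odd_faces fst grid_other_face P = {}"
proof
  assume "P \<in> range (edge_cut fst grid_end)"
  then obtain T where T: "P = edge_cut fst grid_end T" by blast
  have "(i, j) \<notin> odd_faces fst grid_other_face P" for i j
    unfolding grid_odd_face[OF assms] unfolding T edge_cut_def by (auto simp: add.commute)
  then show "odd_faces fst grid_other_face P = {}" by auto
next
  assume ev: "odd_faces fst grid_other_face P = {}"
  define t where "t x y = odd (card {x'. x \<le> x' \<and> ((x', y), True) \<in> P})" for x y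
  have fin: "finite {x'. x \<le> x' \<and> ((x', y), True) \<in> P}" for x y
    by (rule finite_subset[OF _ finite_imageI[OF assms, of "fst \<circ> fst"]]) force
  have step: "t x y \<longleftrightarrow> (t (x + 1) y \<noteq> (((x, y), True) \<in> P))" for x y
  proof -
    let ?A = "{x'. x + 1 \<le> x' \<and> ((x', y), True) \<in> P}"
    have "x \<le> x' \<longleftrightarrow> x' = x \<or> x + 1 \<le> x'" for x' :: int by linarith
    then have "{x'. x \<le> x' \<and> ((x', y), True) \<in> P} = (if ((x, y), True) \<in> P then insert x ?A else ?A)"
      by auto
    then show ?thesis using fin[of "x + 1" y] by (simp add: t_def)
  qed
  have "finite (fst ` fst ` P)" using assms by simp
  then obtain M where M: "\<And>x. x \<in> fst ` fst ` P \<Longrightarrow> x < M"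
    by (meson bdd_above_finite bdd_above.E zle_add1_eq_le less_add_one le_less_trans)
  have vert: "(t x y \<noteq> t x (y + 1)) \<longleftrightarrow> ((x, y), False) \<in> P" for x y
  proof (cases "x \<ge> M")
    case True
    then have "{x'. x \<le> x' \<and> ((x', y), True) \<in> P} = {}" for y using M by force
    then have "\<not> t x y" for y by (simp only: t_def card.empty) simp
    moreover have "((x, y), False) \<notin> P" using True M by force
    ultimately show ?thesis by simp
  next
    case False
    then have "x \<le> M" by simp
    then show ?thesis
    proof (induction x rule: int_le_induct)
      case base
      have "{x'. M \<le> x' \<and> ((x', y), True) \<in> P} = {}" for y using M by force
      then have "\<not> t M y" for y by (simp only: t_def card.empty) simp
      moreover have "((M, y), False) \<notin> P" using M by force
      ultimately show ?case by simp
    next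
      case (step x)
      have "(x - 1, y) \<notin> odd_faces fst grid_other_face P" using ev by simp
      then show ?case using step.IH \<open>\<And>x y. t x y \<longleftrightarrow> (t (x + 1) y \<noteq> (((x, y), True) \<in> P))\<close>[of "x - 1"]
        unfolding grid_odd_face[OF assms] by auto
    qed
  qed
  have "P = edge_cut fst grid_end {(x, y). t x y}"
  proof (rule set_eqI)
    fix e :: grid_edge
    obtain x y b where e: "e = ((x, y), b)" by (metis surj_pair)
    show "e \<in> P \<longleftrightarrow> e \<in> edge_cut fst grid_end {(x, y). t x y}"
      unfolding e edge_cut_def using step[of x y] vert[of x y] by (cases b) auto
  qed
  then show "P \<in> range (edge_cut fst grid_end)" by blast
qed

definition grid_adj :: "((int \<times> int) \<times> (int \<times> int)) set" where
  "grid_adj = {(p, q). \<exists>g. {p, q} = {fst g, grid_end g}}"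

lemma sym_grid_adj: "sym grid_adj"
  unfolding grid_adj_def sym_def by (auto simp: insert_commute)

definition linked :: "('v \<times> 'v) set \<Rightarrow> 'v set \<Rightarrow> bool" where
  "linked R B \<longleftrightarrow> (\<forall>p\<in>B. \<forall>q\<in>B. (p, q) \<in> (R \<inter> B \<times> B)\<^sup>*)"

text \<open>The sets \<open>BB v\<close> are the branch sets of a minor of the grid and \<open>eh e\<close> is the grid edge that stands
  for \<open>e\<close>. The grid edges within a branch set are contracted, the other ones near the branch sets
  deleted. The grid edges away from the branch sets are treated as contracted, which keeps the set
  of deleted edges finite and does not matter as the cuts of the branch sets avoid them.\<close>

lemma grid_minor_dual:
  fixes BB :: "'v \<Rightarrow> (int \<times> int) set" and eh :: "'e \<Rightarrow> grid_edge"
  assumes fV: "finite Vs" and fB: "\<And>v. v \<in> Vs \<Longrightarrow> finite (BB v)"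
    and disj: "\<And>v w. v \<in> Vs \<Longrightarrow> w \<in> Vs \<Longrightarrow> v \<noteq> w \<Longrightarrow> BB v \<inter> BB w = {}"
    and conn: "\<And>v. v \<in> Vs \<Longrightarrow> linked grid_adj (BB v)"
    and fX: "finite X" and inj: "inj_on eh X"
    and ab: "\<And>e. e \<in> X \<Longrightarrow> a e \<in> Vs \<and> b e \<in> Vs \<and> a e \<noteq> b e"
    and ends: "\<And>e. e \<in> X \<Longrightarrow> \<exists>p\<in>BB (a e). \<exists>q\<in>BB (b e). {p, q} = {fst (eh e), grid_end (eh e)}"
  shows "\<exists>l r :: 'e \<Rightarrow> int \<times> int. \<forall>P\<subseteq>X.
           (\<exists>T\<subseteq>Vs. P = X \<inter> edge_cut a b T) \<longleftrightarrow> odd_faces l r P = {}"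
proof -
  define U where "U = (\<Union>v\<in>Vs. BB v)"
  have fU: "finite U" unfolding U_def using fV fB by blast
  define Z where "Z = {g. fst g \<in> U \<or> grid_end g \<in> U}"
  have fZ: "finite Z"
  proof (rule finite_subset)
    show "Z \<subseteq> (U \<union> (\<lambda>(i, j). (i - 1, j)) ` U \<union> (\<lambda>(i, j). (i, j - 1)) ` U) \<times> UNIV"
      unfolding Z_def by (force split: if_splits)
  qed (use fU in simp)
  define Ctr where "Ctr = {g. \<exists>v\<in>Vs. fst g \<in> BB v \<and> grid_end g \<in> BB v}"
  define Del where "Del = Z - Ctr - eh ` X"
  have "finite Del" unfolding Del_def using fZ by blast
  then have "\<exists>l r :: grid_edge \<Rightarrow> int \<times> int. \<forall>P. finite P \<longrightarrow> P \<inter> Del = {} \<longrightarrow>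
      ((\<exists>Q\<in>range (edge_cut fst grid_end). finite Q \<and> Q - Del = P) \<longleftrightarrow> odd_faces l r P = {})"
    by (rule dual_of_deletion) (rule grid_dual)
  then obtain l r :: "grid_edge \<Rightarrow> int \<times> int" where lr0: "\<forall>P. finite P \<longrightarrow> P \<inter> Del = {} \<longrightarrow>
      ((\<exists>Q\<in>range (edge_cut fst grid_end). finite Q \<and> Q - Del = P) \<longleftrightarrow> odd_faces l r P = {})"
    by (elim exE that)
  note lr = lr0[rule_format]
  have re: "odd_faces (l \<circ> eh) (r \<circ> eh) P = odd_faces l r (eh ` P)" if "P \<subseteq> X" for P
    unfolding odd_faces_def face_degree_def
    by (subst sum.reindex) (use inj that in \<open>auto intro: inj_on_subset simp: o_def\<close>)
  have only: "v = w" if "v \<in> Vs" "w \<in> Vs" "p \<in> BB v" "p \<in> BB w" for v w p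
    using disj[OF that(1,2)] that(3,4) by (cases "v = w") auto
  have nCtr: "eh e \<notin> Ctr" if e: "e \<in> X" for e
  proof
    assume "eh e \<in> Ctr"
    then obtain v where v: "v \<in> Vs" "fst (eh e) \<in> BB v" "grid_end (eh e) \<in> BB v"
      unfolding Ctr_def by blast
    obtain p q where pq: "p \<in> BB (a e)" "q \<in> BB (b e)" "{p, q} = {fst (eh e), grid_end (eh e)}"
      using ends[OF e] by blast
    have "p \<in> BB v" "q \<in> BB v" using v pq(3) by (auto simp: doubleton_eq_iff)
    then show False using only[of v "a e" p] only[of v "b e" q] v pq ab[OF e] by simp
  qed
  have ecut: "eh e \<in> edge_cut fst grid_end S \<longleftrightarrow> e \<in> edge_cut a b T"
    if e: "e \<in> X" and S: "\<And>v p. v \<in> Vs \<Longrightarrow> p \<in> BB v \<Longrightarrow> p \<in> S \<longleftrightarrow> v \<in> T" for e S T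
  proof -
    obtain p q where pq: "p \<in> BB (a e)" "q \<in> BB (b e)" "{p, q} = {fst (eh e), grid_end (eh e)}"
      using ends[OF e] by blast
    have "p \<in> S \<longleftrightarrow> a e \<in> T" "q \<in> S \<longleftrightarrow> b e \<in> T" using S pq ab[OF e] by auto
    moreover have "(fst (eh e) \<in> S) \<noteq> (grid_end (eh e) \<in> S) \<longleftrightarrow> (p \<in> S) \<noteq> (q \<in> S)"
      using pq(3) by (auto simp: doubleton_eq_iff)
    ultimately show ?thesis unfolding edge_cut_def by simp
  qed
  show ?thesis
  proof (rule exI[of _ "l \<circ> eh"], rule exI[of _ "r \<circ> eh"], intro allI impI iffI)
    fix P assume P: "P \<subseteq> X"
    then have fP: "finite (eh ` P)" using fX finite_subset by blast
    have PD: "eh ` P \<inter> Del = {}" using P unfolding Del_def by blast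
    { assume "\<exists>T\<subseteq>Vs. P = X \<inter> edge_cut a b T"
      then obtain T where T: "T \<subseteq> Vs" "P = X \<inter> edge_cut a b T" by blast
      define S where "S = (\<Union>v\<in>T. BB v)"
      have S: "p \<in> S \<longleftrightarrow> v \<in> T" if "v \<in> Vs" "p \<in> BB v" for v p
        using that T(1) only[OF that(1)] unfolding S_def by blast
      have sub: "edge_cut fst grid_end S \<subseteq> Z - Ctr"
      proof
        fix g assume g: "g \<in> edge_cut fst grid_end S"
        have "g \<in> Z" using g T unfolding edge_cut_def Z_def S_def U_def by blast
        moreover have "g \<notin> Ctr" using g S unfolding edge_cut_def Ctr_def by blast
        ultimately show "g \<in> Z - Ctr" by blast
      qed
      have "edge_cut fst grid_end S - Del = eh ` P"
        using sub ecut[OF _ S] unfolding Del_def T(2) by blast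
      moreover have "finite (edge_cut fst grid_end S)" using sub fZ by (meson finite_Diff finite_subset)
      ultimately have "odd_faces l r (eh ` P) = {}" using lr[OF fP PD] by blast
      then show "odd_faces (l \<circ> eh) (r \<circ> eh) P = {}" using re[OF P] by simp }
    { assume "odd_faces (l \<circ> eh) (r \<circ> eh) P = {}"
      then obtain S where S: "edge_cut fst grid_end S - Del = eh ` P"
        using lr[OF fP PD] re[OF P] by auto
      define T where "T = {v \<in> Vs. BB v \<inter> S \<noteq> {}}"
      have T: "p \<in> S \<longleftrightarrow> v \<in> T" if v: "v \<in> Vs" and p: "p \<in> BB v" for v p
      proof -
        have const: "q \<in> S \<longleftrightarrow> p \<in> S" if "q \<in> BB v" for q
        proof -
          have "(p, q) \<in> (grid_adj \<inter> BB v \<times> BB v)\<^sup>*"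
            using conn[OF v] p that unfolding linked_def by blast
          then show ?thesis
          proof (induction rule: rtrancl_induct)
            case (step y z)
            then obtain g where g: "{y, z} = {fst g, grid_end g}" unfolding grid_adj_def by blast
            have "g \<in> Ctr" unfolding Ctr_def using step.hyps g v by (auto simp: doubleton_eq_iff)
            then have "g \<notin> eh ` P" "g \<notin> Del" using nCtr P unfolding Del_def by blast+
            then have "g \<notin> edge_cut fst grid_end S" using S by blast
            then show ?case using step.IH g unfolding edge_cut_def by (auto simp: doubleton_eq_iff)
          qed simp
        qed
        then show ?thesis unfolding T_def using v p by blast
      qed
      have "P = X \<inter> edge_cut a b T"
      proof (intro set_eqI iffI)
        fix e assume "e \<in> P"
        then show "e \<in> X \<inter> edge_cut a b T" using S P ecut[of e S T] T by blast
      next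
        fix e assume e: "e \<in> X \<inter> edge_cut a b T"
        then have "eh e \<in> edge_cut fst grid_end S" using ecut[of e S T] T by blast
        moreover have "eh e \<notin> Del" using e unfolding Del_def by blast
        ultimately have "eh e \<in> eh ` P" using S by blast
        then show "e \<in> P" using inj e P by (auto dest: inj_onD)
      qed
      moreover have "T \<subseteq> Vs" unfolding T_def by auto
      ultimately show "\<exists>T\<subseteq>Vs. P = X \<inter> edge_cut a b T" by (intro exI[of _ T] conjI) }
  qed
qed

section \<open>Continua in the plane and pixels\<close>

definition cell :: "real \<Rightarrow> int \<times> int \<Rightarrow> (real ^ 2) set" where
  "cell h p = {z. h * fst p \<le> z $ 1 \<and> z $ 1 \<le> h * (fst p + 1) \<and>
                  h * snd p \<le> z $ 2 \<and> z $ 2 \<le> h * (snd p + 1)}"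

definition pixels :: "real \<Rightarrow> (real ^ 2) set \<Rightarrow> (int \<times> int) set" where
  "pixels h A = {p. cell h p \<inter> A \<noteq> {}}"

lemma closed_cell: "closed (cell h p)"
proof -
  have "closed ({z::real^2. h * fst p \<le> z $ 1} \<inter> {z. z $ 1 \<le> h * (fst p + 1)} \<inter>
     {z. h * snd p \<le> z $ 2} \<inter> {z. z $ 2 \<le> h * (snd p + 1)})"
    by (intro closed_Int closed_Collect_le continuous_intros)
  also have "\<dots> = cell h p" by (auto simp: cell_def)
  finally show ?thesis .
qed

lemma in_some_cell:
  assumes "h > 0"
  shows "\<exists>p. z \<in> cell h p"
proof -
  have "h * \<lfloor>x / h\<rfloor> \<le> x \<and> x \<le> h * (\<lfloor>x / h\<rfloor> + 1)" for x
  proof -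
    have "\<lfloor>x / h\<rfloor> \<le> x / h" "x / h \<le> \<lfloor>x / h\<rfloor> + 1" by linarith+
    then have "h * \<lfloor>x / h\<rfloor> \<le> h * (x / h)" "h * (x / h) \<le> h * (\<lfloor>x / h\<rfloor> + 1)"
      using assms by (intro mult_left_mono; simp)+
    then show ?thesis using assms by simp
  qed
  then have "z \<in> cell h (\<lfloor>z $ 1 / h\<rfloor>, \<lfloor>z $ 2 / h\<rfloor>)" unfolding cell_def by simp
  then show ?thesis by blast
qed

lemma pixels_Int_nonempty:
  assumes "h > 0" "A \<inter> B \<noteq> {}"
  shows "pixels h A \<inter> pixels h B \<noteq> {}"
  using in_some_cell[OF assms(1)] assms(2) unfolding pixels_def by blast

lemma finite_pixels:
  assumes h: "h > 0" and A: "bounded A"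
  shows "finite (pixels h A)"
proof -
  obtain M where M: "\<And>z. z \<in> A \<Longrightarrow> norm z \<le> M" using A unfolding bounded_iff by blast
  define N where "N = \<lceil>M / h\<rceil> + 1"
  have "pixels h A \<subseteq> {- N..N} \<times> {- N..N}"
  proof
    fix p assume "p \<in> pixels h A"
    then obtain z where z: "z \<in> cell h p" "z \<in> A" unfolding pixels_def by blast
    have b: "i \<in> {- N..N}" if "h * i \<le> x" "x \<le> h * (i + 1)" "\<bar>x\<bar> \<le> M" for i :: int and x
    proof -
      have "h * i \<le> M" "- M \<le> h * (i + 1)" using that by linarith+
      then have "i \<le> M / h" "- (M / h) \<le> i + 1" using h by (auto simp: field_simps)
      then have "i \<le> \<lceil>M / h\<rceil>" "- (\<lceil>M / h\<rceil>) \<le> i + 1" by linarith+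
      then show ?thesis unfolding N_def by auto
    qed
    have "\<bar>z $ 1\<bar> \<le> M" "\<bar>z $ 2\<bar> \<le> M"
      using M[OF z(2)] component_le_norm_cart[of z] order_trans by blast+
    then have "fst p \<in> {- N..N}" "snd p \<in> {- N..N}" using z(1) b unfolding cell_def by auto
    then show "p \<in> {- N..N} \<times> {- N..N}" by (simp add: mem_Times_iff)
  qed
  then show ?thesis by (rule finite_subset) simp
qed

lemma eventually_pixels_disjoint:
  assumes "compact A" "compact B" "A \<inter> B = {}"
  shows "\<forall>\<^sub>F h in at_right 0. pixels h A \<inter> pixels h B = {}"
proof -
  obtain d where d: "d > 0" "\<And>x y. x \<in> A \<Longrightarrow> y \<in> B \<Longrightarrow> d \<le> dist x y"
    using separate_compact_closed[OF assms(1) compact_imp_closed[OF assms(2)] assms(3)] by auto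
  have "pixels h A \<inter> pixels h B = {}" if h: "0 < h" "h < d / 2" for h
  proof (rule ccontr)
    assume "\<not> ?thesis"
    then obtain p x y where *: "x \<in> cell h p" "x \<in> A" "y \<in> cell h p" "y \<in> B"
      unfolding pixels_def by blast
    have "norm (x - y) \<le> (\<Sum>i\<in>UNIV. \<bar>(x - y) $ i\<bar>)" by (rule norm_le_l1_cart)
    also have "\<dots> = \<bar>x $ 1 - y $ 1\<bar> + \<bar>x $ 2 - y $ 2\<bar>" by (simp add: sum_2)
    also have "\<dots> \<le> h + h"
      using *(1,3) unfolding cell_def by (intro add_mono) (auto simp: algebra_simps abs_le_iff)
    also have "\<dots> < d" using h by simp
    finally show False using d(2)[of x y] * by (simp add: dist_norm)
  qed
  then show ?thesis using d(1) unfolding eventually_at_right_field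
    by (intro exI[of _ "d / 2"]) simp
qed

lemma grid_adjI:
  "\<bar>fst p - fst q\<bar> + \<bar>snd p - snd q\<bar> = 1 \<Longrightarrow> (p, q) \<in> grid_adj"
proof -
  obtain i j i' j' where pq: "p = (i, j)" "q = (i', j')" by (metis surj_pair)
  assume "\<bar>fst p - fst q\<bar> + \<bar>snd p - snd q\<bar> = 1"
  then have "i' = i + 1 \<and> j' = j \<or> i = i' + 1 \<and> j' = j \<or> i' = i \<and> j' = j + 1 \<or> i' = i \<and> j = j' + 1"
    unfolding pq by auto
  then consider "{p, q} = {fst (p, True), grid_end (p, True)}" | "{p, q} = {fst (q, True), grid_end (q, True)}"
    | "{p, q} = {fst (p, False), grid_end (p, False)}" | "{p, q} = {fst (q, False), grid_end (q, False)}"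
    unfolding pq by (auto simp: insert_commute)
  then show ?thesis unfolding grid_adj_def by cases blast+
qed

text \<open>If two pixels share just a corner, then the two other pixels at this corner contain it as well.
  So pixels in different linked classes have no point of \<open>A\<close> in common, and the classes would split
  \<open>A\<close> into disjoint closed parts.\<close>

lemma linked_pixels:
  assumes h: "h > 0" and A: "connected A" "bounded A"
  shows "linked grid_adj (pixels h A)"
  unfolding linked_def
proof (intro ballI)
  fix p q assume p: "p \<in> pixels h A" and q: "q \<in> pixels h A"
  let ?R = "grid_adj \<inter> pixels h A \<times> pixels h A"
  define C where "C = {q. (p, q) \<in> ?R\<^sup>*}"
  have CA: "C \<subseteq> pixels h A" unfolding C_def using p by (auto elim: rtranclE)
  define U1 where "U1 = (\<Union>c\<in>C. cell h c)"
  define U2 where "U2 = (\<Union>c\<in>pixels h A - C. cell h c)"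
  have fin: "finite (pixels h A)" by (rule finite_pixels[OF h A(2)])
  have cl: "closed U1" "closed U2"
    unfolding U1_def U2_def using fin CA finite_subset by (auto intro!: closed_UN closed_cell)
  have step: "s \<in> C" if "r \<in> C" "s \<in> pixels h A" "\<bar>fst r - fst s\<bar> + \<bar>snd r - snd s\<bar> \<le> 1" for r s
  proof (cases "r = s")
    case False
    then have "\<bar>fst r - fst s\<bar> + \<bar>snd r - snd s\<bar> = 1"
      using that(3) by (smt (verit) prod.expand)
    then have "(r, s) \<in> ?R" using that CA by (auto intro!: grid_adjI)
    then show ?thesis using that(1) unfolding C_def by (auto intro: rtrancl_into_rtrancl)
  qed (use that in simp)
  have "U1 \<inter> U2 \<inter> A = {}"
  proof (rule ccontr)
    assume "\<not> ?thesis"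
    then obtain z r s where z: "z \<in> A" "r \<in> C" "z \<in> cell h r" "s \<in> pixels h A" "s \<notin> C" "z \<in> cell h s"
      unfolding U1_def U2_def by blast
    have near: "\<bar>i - i'\<bar> \<le> 1" if "h * i \<le> x" "x \<le> h * (i + 1)" "h * i' \<le> x" "x \<le> h * (i' + 1)"
      for i i' :: int and x
    proof -
      have "h * real_of_int i \<le> h * (i' + 1)" "h * real_of_int i' \<le> h * (i + 1)" using that by linarith+
      then have "real_of_int i \<le> i' + 1" "real_of_int i' \<le> i + 1" using h by simp_all
      then show ?thesis by linarith
    qed
    \<comment> \<open>a pixel in the column of \<open>s\<close> and the row of \<open>r\<close>, hence adjacent or equal to both\<close>
    define m where "m = (fst s, snd r)"
    have zm: "z \<in> cell h m" using z unfolding cell_def m_def by simp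
    then have "m \<in> pixels h A" using z(1) unfolding pixels_def by blast
    moreover have "\<bar>fst r - fst s\<bar> \<le> 1" using z(3,6) unfolding cell_def by (intro near[of _ "z $ 1"]) auto
    moreover have "\<bar>snd r - snd s\<bar> \<le> 1" using z(3,6) unfolding cell_def by (intro near[of _ "z $ 2"]) auto
    ultimately show False
      using step[of r m] step[of m s] z unfolding m_def by simp
  qed
  moreover have "A \<subseteq> U1 \<union> U2"
    using in_some_cell[OF h] unfolding U1_def U2_def pixels_def by blast
  moreover have "U1 \<inter> A \<noteq> {}"
  proof -
    have "p \<in> C" unfolding C_def by simp
    then show ?thesis using p unfolding U1_def pixels_def by blast
  qed
  ultimately have U2: "U2 \<inter> A = {}"
    using A(1) cl unfolding connected_closed by blast
  have "q \<in> C"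
  proof (rule ccontr)
    assume "q \<notin> C"
    then have "cell h q \<subseteq> U2" using q unfolding U2_def by blast
    then show False using q U2 unfolding pixels_def by blast
  qed
  then show "(p, q) \<in> ?R\<^sup>*" unfolding C_def by simp
qed

lemma rtrancl_mono_restrict: "(x, y) \<in> (R \<inter> A \<times> A)\<^sup>* \<Longrightarrow> A \<subseteq> B \<Longrightarrow> (x, y) \<in> (R \<inter> B \<times> B)\<^sup>*"
  by (erule rtrancl_mono[THEN subsetD, rotated]) blast

lemma linked_UnI:
  assumes sym: "sym R" and B: "linked R B"
    and D: "\<And>d. d \<in> D \<Longrightarrow> \<exists>b\<in>B. (b, d) \<in> (R \<inter> (B \<union> D) \<times> (B \<union> D))\<^sup>*"
  shows "linked R (B \<union> D)"
proof -
  let ?R = "R \<inter> (B \<union> D) \<times> (B \<union> D)"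
  have sy: "sym (?R\<^sup>*)" using sym by (intro sym_rtrancl) (auto simp: sym_def)
  have fromB: "\<exists>b\<in>B. (b, x) \<in> ?R\<^sup>*" if "x \<in> B \<union> D" for x
    using that D by blast
  have BB: "(b, c) \<in> ?R\<^sup>*" if "b \<in> B" "c \<in> B" for b c
  proof -
    have "(b, c) \<in> (R \<inter> B \<times> B)\<^sup>*" using B that unfolding linked_def by simp
    then show ?thesis by (rule rtrancl_mono_restrict) simp
  qed
  show ?thesis unfolding linked_def
  proof (intro ballI)
    fix x y assume "x \<in> B \<union> D" "y \<in> B \<union> D"
    then obtain b c where "b \<in> B" "(b, x) \<in> ?R\<^sup>*" "c \<in> B" "(c, y) \<in> ?R\<^sup>*" using fromB by meson
    then show "(x, y) \<in> ?R\<^sup>*" using BB[of b c] sy by (meson rtrancl_trans symD)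
  qed
qed

text \<open>A path in \<open>C\<close> from \<open>A\<close> to \<open>B\<close> is followed until it enters \<open>B\<close>; \<open>D\<close> is what can be reached
  before, and \<open>(x, y)\<close> is the first step into \<open>B\<close>.\<close>

lemma linked_exit:
  assumes C: "linked R C" and p: "p \<in> C \<inter> A" and q: "q \<in> C \<inter> B" and AB: "A \<inter> B = {}"
  shows "\<exists>D x y. D \<subseteq> C - B \<and> x \<in> D \<and> y \<in> C \<inter> B \<and> (x, y) \<in> R \<and> 
           (\<forall>d\<in>D. \<exists>a\<in>A \<inter> D. (a, d) \<in> (R \<inter> D \<times> D)\<^sup>*)"
proof -
  define D where "D = {d. (p, d) \<in> (R \<inter> (C - B) \<times> (C - B))\<^sup>*}"
  have pC: "p \<in> C - B" using p AB by blast
  have DC: "D \<subseteq> C - B" unfolding D_def using pC by (auto elim: rtranclE)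
  have pD: "p \<in> D" unfolding D_def by simp
  have reach: "(p, d) \<in> (R \<inter> D \<times> D)\<^sup>*" if "d \<in> D" for d
  proof -
    have "(p, d) \<in> (R \<inter> (C - B) \<times> (C - B))\<^sup>*" using that unfolding D_def by simp
    then show ?thesis
    proof (induction rule: rtrancl_induct)
      case (step y z)
      then have "y \<in> D" "z \<in> D" unfolding D_def by (auto intro: rtrancl_into_rtrancl)
      then show ?case using step by (intro rtrancl_into_rtrancl[OF step.IH]) auto
    qed simp
  qed
  have "(p, q) \<in> (R \<inter> C \<times> C)\<^sup>*" using C p q unfolding linked_def by blast
  moreover have "q \<notin> D" using q DC by blast
  ultimately have "\<exists>x y. x \<in> D \<and> y \<notin> D \<and> (x, y) \<in> R \<inter> C \<times> C"
  proof (induction rule: rtrancl_induct)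
    case base then show ?case using pD by simp
  next
    case (step y z) then show ?case by blast
  qed
  then obtain x y where xy: "x \<in> D" "y \<notin> D" "(x, y) \<in> R" "y \<in> C" by blast
  have "y \<in> B"
  proof (rule ccontr)
    assume "y \<notin> B"
    then have "(x, y) \<in> R \<inter> (C - B) \<times> (C - B)" using xy DC by blast
    then have "y \<in> D" using xy(1) unfolding D_def by (auto intro: rtrancl_into_rtrancl)
    then show False using xy by simp
  qed
  then show ?thesis using DC xy reach p pD by (intro exI[of _ D] exI[of _ x] exI[of _ y]) auto
qed

text \<open>A drawing whose vertices are disjoint continua \<open>K v\<close> and whose edges are disjoint continua \<open>J e\<close>,
  each touching the two continua at its ends, is a minor of a fine enough grid. The branch set of
  \<open>v\<close> consists of the pixels of \<open>K v\<close> and, for the edges \<open>e\<close> starting at \<open>v\<close>, of the pixels of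
  \<open>J e\<close> that are reached before \<open>K (b e)\<close>. The step into \<open>K (b e)\<close> is the grid edge for \<open>e\<close>; it
  stays within the pixels of \<open>J e\<close>, so parallel edges get different grid edges.\<close>

lemma continuum_dual:
  fixes K :: "'v \<Rightarrow> (real ^ 2) set" and J :: "'e \<Rightarrow> (real ^ 2) set"
  assumes fV: "finite Vs" and fX: "finite X"
    and K: "\<And>v. v \<in> Vs \<Longrightarrow> compact (K v) \<and> connected (K v)"
    and KK: "\<And>v w. v \<in> Vs \<Longrightarrow> w \<in> Vs \<Longrightarrow> v \<noteq> w \<Longrightarrow> K v \<inter> K w = {}"
    and J: "\<And>e. e \<in> X \<Longrightarrow> compact (J e) \<and> connected (J e)"
    and JJ: "\<And>e f. e \<in> X \<Longrightarrow> f \<in> X \<Longrightarrow> e \<noteq> f \<Longrightarrow> J e \<inter> J f = {}"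
    and ab: "\<And>e. e \<in> X \<Longrightarrow> a e \<in> Vs \<and> b e \<in> Vs \<and> a e \<noteq> b e"
    and JK: "\<And>e. e \<in> X \<Longrightarrow> J e \<inter> K (a e) \<noteq> {} \<and> J e \<inter> K (b e) \<noteq> {}"
    and JK0: "\<And>e v. e \<in> X \<Longrightarrow> v \<in> Vs \<Longrightarrow> v \<noteq> a e \<Longrightarrow> v \<noteq> b e \<Longrightarrow> J e \<inter> K v = {}"
  shows "\<exists>l r :: 'e \<Rightarrow> int \<times> int. \<forall>P\<subseteq>X.
           (\<exists>T\<subseteq>Vs. P = X \<inter> edge_cut a b T) \<longleftrightarrow> odd_faces l r P = {}"
proof -
  have "\<forall>\<^sub>F h in at_right 0. 0 < (h::real) \<and>
      (\<forall>v\<in>Vs. \<forall>w\<in>Vs. v \<noteq> w \<longrightarrow> pixels h (K v) \<inter> pixels h (K w) = {}) \<and>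
      (\<forall>e\<in>X. \<forall>f\<in>X. e \<noteq> f \<longrightarrow> pixels h (J e) \<inter> pixels h (J f) = {}) \<and>
      (\<forall>e\<in>X. \<forall>v\<in>Vs. v \<noteq> a e \<and> v \<noteq> b e \<longrightarrow> pixels h (J e) \<inter> pixels h (K v) = {})"
  proof (intro eventually_conj eventually_ball_finite ballI fV fX)
    have ev: "\<forall>\<^sub>F h in at_right 0. c \<longrightarrow> pixels h A \<inter> pixels h B = {}"
      if "c \<Longrightarrow> compact A \<and> compact B \<and> A \<inter> B = {}" for c A B
      using eventually_pixels_disjoint[of A B] that by (cases c) auto
    show "\<forall>\<^sub>F h in at_right 0. 0 < (h::real)" by (rule eventually_at_right_less)
    show "\<forall>\<^sub>F h in at_right 0. v \<noteq> w \<longrightarrow> pixels h (K v) \<inter> pixels h (K w) = {}"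
      if "v \<in> Vs" "w \<in> Vs" for v w using K KK that by (intro ev) auto
    show "\<forall>\<^sub>F h in at_right 0. e \<noteq> f \<longrightarrow> pixels h (J e) \<inter> pixels h (J f) = {}"
      if "e \<in> X" "f \<in> X" for e f using J JJ that by (intro ev) auto
    show "\<forall>\<^sub>F h in at_right 0. v \<noteq> a e \<and> v \<noteq> b e \<longrightarrow> pixels h (J e) \<inter> pixels h (K v) = {}"
      if "e \<in> X" "v \<in> Vs" for e v using J K JK0 that by (intro ev) auto
  qed
  from eventually_happens'[OF trivial_limit_at_right_real this]
  obtain h :: real where h: "0 < h"
    and hK: "\<And>v w. v \<in> Vs \<Longrightarrow> w \<in> Vs \<Longrightarrow> v \<noteq> w \<Longrightarrow> pixels h (K v) \<inter> pixels h (K w) = {}"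
    and hJ: "\<And>e f. e \<in> X \<Longrightarrow> f \<in> X \<Longrightarrow> e \<noteq> f \<Longrightarrow> pixels h (J e) \<inter> pixels h (J f) = {}"
    and hJK: "\<And>e v. e \<in> X \<Longrightarrow> v \<in> Vs \<Longrightarrow> v \<noteq> a e \<Longrightarrow> v \<noteq> b e \<Longrightarrow> pixels h (J e) \<inter> pixels h (K v) = {}"
    by (elim exE conjE) simp
  define Q where "Q e D x y \<longleftrightarrow> D \<subseteq> pixels h (J e) - pixels h (K (b e)) \<and> x \<in> D \<and>
      y \<in> pixels h (J e) \<inter> pixels h (K (b e)) \<and> (x, y) \<in> grid_adj \<and>
      (\<forall>d\<in>D. \<exists>p\<in>pixels h (K (a e)) \<inter> D. (p, d) \<in> (grid_adj \<inter> D \<times> D)\<^sup>*)" for e D x y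
  have "\<exists>D x y. Q e D x y" if e: "e \<in> X" for e
  proof -
    have "linked grid_adj (pixels h (J e))" using linked_pixels[OF h] J[OF e] compact_imp_bounded by blast
    moreover obtain p where "p \<in> pixels h (J e) \<inter> pixels h (K (a e))"
      using pixels_Int_nonempty[OF h] JK[OF e] by blast
    moreover obtain q where "q \<in> pixels h (J e) \<inter> pixels h (K (b e))"
      using pixels_Int_nonempty[OF h] JK[OF e] by blast
    moreover have "pixels h (K (a e)) \<inter> pixels h (K (b e)) = {}" using ab[OF e] hK by blast
    ultimately show ?thesis unfolding Q_def by (rule linked_exit)
  qed
  then obtain D x y where Q: "\<And>e. e \<in> X \<Longrightarrow> Q e (D e) (x e) (y e)" by metis
  have D: "D e \<subseteq> pixels h (J e)" "D e \<inter> pixels h (K (b e)) = {}" "x e \<in> D e"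
      "y e \<in> pixels h (J e)" "y e \<in> pixels h (K (b e))" "(x e, y e) \<in> grid_adj"
      "\<And>d. d \<in> D e \<Longrightarrow> \<exists>p\<in>pixels h (K (a e)). (p, d) \<in> (grid_adj \<inter> D e \<times> D e)\<^sup>*"
    if "e \<in> X" for e
    using Q[OF that] unfolding Q_def by blast+
  have "\<exists>g. {x e, y e} = {fst g, grid_end g}" if "e \<in> X" for e
    using D(6)[OF that] unfolding grid_adj_def by simp
  then obtain eh where eh: "\<And>e. e \<in> X \<Longrightarrow> {x e, y e} = {fst (eh e), grid_end (eh e)}" by metis
  define BB where "BB v = pixels h (K v) \<union> (\<Union>e\<in>{e \<in> X. a e = v}. D e)" for v
  show ?thesis
  proof (rule grid_minor_dual[where BB = BB and eh = eh])
    show "finite Vs" "finite X" by fact+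
    show "finite (BB v)" if "v \<in> Vs" for v
    proof -
      have "finite (pixels h (K v))" using finite_pixels[OF h] K[OF that] compact_imp_bounded by blast
      moreover have "finite (D e)" if "e \<in> X" for e
        using finite_subset[OF D(1)[OF that] finite_pixels[OF h compact_imp_bounded]] J[OF that] by simp
      ultimately show ?thesis unfolding BB_def using fX by auto
    qed
    have DK: "pixels h (K v) \<inter> D e = {}" if "v \<in> Vs" "e \<in> X" "v \<noteq> a e" for v e
      using D(1,2)[OF that(2)] hJK[OF that(2,1,3)] by (cases "v = b e") auto
    have DD: "D e \<inter> D f = {}" if "e \<in> X" "f \<in> X" "e \<noteq> f" for e f
      using D(1)[OF that(1)] D(1)[OF that(2)] hJ[OF that] by blast
    show "BB v \<inter> BB w = {}" if vw: "v \<in> Vs" "w \<in> Vs" "v \<noteq> w" for v w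
    proof (rule ccontr)
      assume "\<not> ?thesis"
      then obtain z where z: "z \<in> BB v" "z \<in> BB w" by blast
      from z(1) consider "z \<in> pixels h (K v)" | e where "e \<in> X" "a e = v" "z \<in> D e"
        unfolding BB_def by blast
      then show False
      proof cases
        case 1
        then show ?thesis using z(2) hK[OF vw] DK[OF vw(1)] vw(3) unfolding BB_def by blast
      next
        case e: 2
        from z(2) consider "z \<in> pixels h (K w)" | f where "f \<in> X" "a f = w" "z \<in> D f"
          unfolding BB_def by blast
        then show ?thesis
        proof cases
          case 1
          then show ?thesis using DK[OF vw(2) e(1)] e vw(3) by blast
        next
          case 2
          then show ?thesis using DD[OF e(1) 2(1)] e vw(3) by blast
        qed
      qed
    qed
    show "linked grid_adj (BB v)" if v: "v \<in> Vs" for v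
      unfolding BB_def
    proof (rule linked_UnI[OF sym_grid_adj])
      show "linked grid_adj (pixels h (K v))" using linked_pixels[OF h] K[OF v] compact_imp_bounded by blast
      fix d assume "d \<in> (\<Union>e\<in>{e \<in> X. a e = v}. D e)"
      then obtain e where e: "e \<in> X" "a e = v" "d \<in> D e" by blast
      obtain p where p: "p \<in> pixels h (K v)" "(p, d) \<in> (grid_adj \<inter> D e \<times> D e)\<^sup>*"
        using D(7)[OF e(1,3)] e(2) by blast
      have "D e \<subseteq> pixels h (K v) \<union> (\<Union>e\<in>{e \<in> X. a e = v}. D e)" using e by blast
      from p(1) rtrancl_mono_restrict[OF p(2) this]
      show "\<exists>p\<in>pixels h (K v). (p, d) \<in> (grid_adj \<inter> (pixels h (K v) \<union> (\<Union>e\<in>{e \<in> X. a e = v}. D e)) \<times>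
          (pixels h (K v) \<union> (\<Union>e\<in>{e \<in> X. a e = v}. D e)))\<^sup>*"
        by (rule bexI[rotated])
    qed
    show "inj_on eh X"
    proof (rule inj_onI, rule ccontr)
      fix e f assume ef: "e \<in> X" "f \<in> X" "eh e = eh f" "e \<noteq> f"
      then have "x e \<in> {x f, y f}" using eh[of e] eh[of f] by auto
      then have "x e \<in> pixels h (J f)" using D(1,3,4)[OF ef(2)] by auto
      moreover have "x e \<in> pixels h (J e)" using D(1,3)[OF ef(1)] by auto
      ultimately show False using hJ[OF ef(1,2,4)] by auto
    qed
    show "a e \<in> Vs \<and> b e \<in> Vs \<and> a e \<noteq> b e" if "e \<in> X" for e using ab[OF that] .
    show "\<exists>p\<in>BB (a e). \<exists>q\<in>BB (b e). {p, q} = {fst (eh e), grid_end (eh e)}" if e: "e \<in> X" for e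
    proof (intro bexI)
      show "{x e, y e} = {fst (eh e), grid_end (eh e)}" using eh[OF e] .
      show "y e \<in> BB (b e)" using D(5)[OF e] unfolding BB_def by simp
      show "x e \<in> BB (a e)" using D(3)[OF e] e unfolding BB_def by blast
    qed
  qed
qed

section \<open>Edge boundaries and connectedness\<close>

lemma simple_graphE:
  assumes "simple_graph V E" "e \<in> E"
  obtains u v where "u \<in> V" "v \<in> V" "u \<noteq> v" "e = {u, v}"
  using assms unfolding simple_graph_def by blast

lemma mem_edge_boundary:
  assumes "simple_graph V E" "S \<subseteq> V" "{u, v} \<in> E"
  shows "{u, v} \<in> edge_boundary V E S \<longleftrightarrow> (u \<in> S) \<noteq> (v \<in> S)"
proof -
  obtain x y where xy: "x \<in> V" "y \<in> V" "{u, v} = {x, y}"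
    using simple_graphE[OF assms(1,3)] by metis
  then have "u \<in> V" "v \<in> V" by (auto simp: doubleton_eq_iff)
  then show ?thesis using assms(2,3) unfolding edge_boundary_def by (auto simp: doubleton_eq_iff)
qed

lemma edge_boundary_subset: "edge_boundary V E S \<subseteq> E"
  unfolding edge_boundary_def by blast

lemma edge_boundary_touches: "e \<in> edge_boundary V E S \<Longrightarrow> e \<inter> S \<noteq> {}"
  unfolding edge_boundary_def by blast

lemma edge_boundary_sym_diff:
  assumes G: "simple_graph V E" and "S \<subseteq> V" "T \<subseteq> V"
  shows "edge_boundary V E (sym_diff S T) =
    sym_diff (edge_boundary V E S) (edge_boundary V E T)"
proof (rule set_eqI)
  fix e
  show "e \<in> edge_boundary V E (sym_diff S T) \<longleftrightarrow>
      e \<in> sym_diff (edge_boundary V E S) (edge_boundary V E T)"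
  proof (cases "e \<in> E")
    case True
    then obtain u v where e: "e = {u, v}" using simple_graphE[OF G] by metis
    have "sym_diff S T \<subseteq> V" using assms by blast
    then show ?thesis
      using True mem_edge_boundary[OF G, of S u v] mem_edge_boundary[OF G, of T u v]
        mem_edge_boundary[OF G, of "sym_diff S T" u v] assms(2,3) unfolding e by auto
  next
    case False
    then show ?thesis using edge_boundary_subset[of V E] by blast
  qed
qed

text \<open>The inclusion \<open>T \<subseteq> reach E T x\<close> is used to say that \<open>T\<close> is connected, seen from \<open>x\<close>.\<close>

definition reach :: "'a set set \<Rightarrow> 'a set \<Rightarrow> 'a \<Rightarrow> 'a set" where
  "reach E A u = {w. (u, w) \<in> (adj E \<inter> A \<times> A)\<^sup>*}"

section \<open>A dual for a finite part of a plane graph\<close>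

lemma finite_vertices_in_compact:
  assumes "compact C" "\<And>x. \<not> vertex_accumulation_point V \<phi> x"
  shows "finite {v \<in> V. \<phi> v \<in> C}"
proof -
  have "\<exists>U. open U \<and> x \<in> U \<and> finite {v \<in> V. \<phi> v \<in> U}" for x
    using assms(2)[of x] unfolding vertex_accumulation_point_def by blast
  then obtain U where U: "\<And>x. open (U x) \<and> x \<in> U x \<and> finite {v \<in> V. \<phi> v \<in> U x}" by metis
  have "C \<subseteq> (\<Union>x\<in>C. U x)" using U by blast
  then obtain C' where C': "C' \<subseteq> C" "finite C'" "C \<subseteq> (\<Union>x\<in>C'. U x)"
    using compactE_image[OF assms(1), of C U] U by metis
  have "{v \<in> V. \<phi> v \<in> C} \<subseteq> (\<Union>x\<in>C'. {v \<in> V. \<phi> v \<in> U x})" using C'(3) by blast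
  then show ?thesis by (rule finite_subset) (use C'(2) U in blast)
qed

lemma connected_star:
  assumes "connected A" "A \<noteq> {}" "\<And>i. i \<in> I \<Longrightarrow> connected (B i) \<and> A \<inter> B i \<noteq> {}"
  shows "connected (A \<union> (\<Union>i\<in>I. B i))"
proof -
  have "A \<union> (\<Union>i\<in>I. B i) = \<Union>(insert A ((\<lambda>i. A \<union> B i) ` I))" by blast
  moreover have "connected (\<Union>(insert A ((\<lambda>i. A \<union> B i) ` I)))"
  proof (rule connected_Union)
    show "connected S" if "S \<in> insert A ((\<lambda>i. A \<union> B i) ` I)" for S
      using that assms by (auto intro!: connected_Un)
    show "\<Inter>(insert A ((\<lambda>i. A \<union> B i) ` I)) \<noteq> {}" using assms(2) by blast
  qed
  ultimately show ?thesis by simp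
qed

lemma plane_representationD:
  assumes "plane_representation V E \<phi> \<gamma>"
  shows "inj_on \<phi> V" and "e \<in> E \<Longrightarrow> arc (\<gamma> e)"
    and "e \<in> E \<Longrightarrow> {pathstart (\<gamma> e), pathfinish (\<gamma> e)} = \<phi> ` e"
    and "e \<in> E \<Longrightarrow> v \<in> V \<Longrightarrow> \<phi> v \<in> path_image (\<gamma> e) \<Longrightarrow> v \<in> e"
    and "e \<in> E \<Longrightarrow> f \<in> E \<Longrightarrow> e \<noteq> f \<Longrightarrow>
      path_image (\<gamma> e) \<inter> path_image (\<gamma> f) \<subseteq> \<phi> ` (e \<inter> f)"
  using assms by (simp_all add: plane_representation_def)

text \<open>Paths of the graph are followed in the drawing. The point \<open>\<phi> u\<close> has to be mentioned since the
  path may be trivial.\<close>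

lemma continuum_along_path:
  assumes rep: "plane_representation V E \<phi> \<gamma>" and "(u, w) \<in> (adj E \<inter> A \<times> A)\<^sup>*"
  shows "\<exists>Z. compact Z \<and> connected Z \<and> \<phi> u \<in> Z \<and> \<phi> w \<in> Z \<and>
     Z \<subseteq> {\<phi> u} \<union> (\<Union>f\<in>{f \<in> E. f \<subseteq> A}. path_image (\<gamma> f))"
  using assms(2)
proof (induction rule: rtrancl_induct)
  case base
  show ?case by (intro exI[of _ "{\<phi> u}"]) simp
next
  case (step y z)
  then obtain Z where Z: "compact Z" "connected Z" "\<phi> u \<in> Z" "\<phi> y \<in> Z"
     "Z \<subseteq> {\<phi> u} \<union> (\<Union>f\<in>{f \<in> E. f \<subseteq> A}. path_image (\<gamma> f))" by blast
  have f: "{y, z} \<in> E" "{y, z} \<subseteq> A" using step.hyps unfolding adj_def by auto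
  note g = plane_representationD(2,3)[OF rep f(1)]
  then have yz: "\<phi> y \<in> path_image (\<gamma> {y, z})" "\<phi> z \<in> path_image (\<gamma> {y, z})"
    using pathstart_in_path_image[of "\<gamma> {y, z}"] pathfinish_in_path_image[of "\<gamma> {y, z}"]
    by (auto simp: doubleton_eq_iff)
  have "compact (path_image (\<gamma> {y, z}))" "connected (path_image (\<gamma> {y, z}))"
    using g(1) by (auto simp: arc_imp_path compact_path_image connected_path_image)
  then show ?case using Z yz f
    by (intro exI[of _ "Z \<union> path_image (\<gamma> {y, z})"]) (auto intro!: connected_Un compact_Un)
qed

lemma connected_meets_sphere:
  fixes Z :: "'n::real_normed_vector set"
  assumes "connected Z" "x \<in> Z" "y \<in> Z" "norm x \<le> \<rho>" "\<rho> \<le> norm y"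
  shows "Z \<inter> sphere 0 \<rho> \<noteq> {}"
proof -
  have "connected (norm ` Z)" using assms(1) by (intro connected_continuous_image continuous_intros)
  then have "{norm x..norm y} \<subseteq> norm ` Z" using assms(2,3) by (intro connected_contains_Icc) auto
  then have "\<rho> \<in> norm ` Z" using assms(4,5) by auto
  then show ?thesis by (auto simp: dist_norm)
qed

text \<open>Let \<open>B\<close> be a finite set of vertices whose complement has no finite component, and contract
  everything outside \<open>B\<close> to one vertex at infinity, \<open>None\<close>. The resulting finite graph is planar:
  take a circle around the drawing of all edges that meet \<open>B\<close>. Every vertex outside \<open>B\<close> next to \<open>B\<close>
  is joined outside \<open>B\<close> to infinitely many vertices, and as only finitely many of those lie within
  the circle, it is joined to the circle by a continuum that avoids the drawing of \<open>B\<close>. The circle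
  and these continua form the vertex at infinity. To make the vertices disjoint from each other,
  each arc is cut in three: the outer thirds go to the vertices and the middle third is the edge.

  As a cut is also the cut of the complement, the cuts of this graph are the boundaries of the
  subsets of \<open>B\<close>. Restricting to \<open>B\<close> is essential: in the whole graph an edge between two half
  planes, say, is a cut, but not the boundary of a finite set.\<close>

lemma boundary_dual:
  fixes V :: "'a set" and E :: "'a set set"
  assumes G: "simple_graph V E" and rep: "plane_representation V E \<phi> \<gamma>"
    and acc: "\<And>x. \<not> vertex_accumulation_point V \<phi> x"
    and B: "B \<subseteq> V" "finite B" and X: "X = {e \<in> E. e \<inter> B \<noteq> {}}" "finite X"
    and inf: "\<And>u. u \<in> V - B \<Longrightarrow> infinite (reach E (V - B) u)"
  shows "\<exists>l r :: 'a set \<Rightarrow> int \<times> int. \<forall>P\<subseteq>X.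
           (\<exists>T\<subseteq>B. P = edge_boundary V E T) \<longleftrightarrow> odd_faces l r P = {}"
proof -
  note inj = plane_representationD(1)[OF rep] and arc = plane_representationD(2)[OF rep]
    and ends = plane_representationD(3)[OF rep] and vert = plane_representationD(4)[OF rep]
    and cross = plane_representationD(5)[OF rep]
  define Q where "Q e s t \<longleftrightarrow> s \<in> V \<and> t \<in> V \<and> s \<noteq> t \<and> {s, t} = e \<and> \<gamma> e 0 = \<phi> s \<and> \<gamma> e 1 = \<phi> t" for e s t
  have "\<exists>s t. Q e s t" if e: "e \<in> E" for e
  proof -
    obtain u v where uv: "u \<in> V" "v \<in> V" "u \<noteq> v" "e = {u, v}" using simple_graphE[OF G e] .
    then have "{pathstart (\<gamma> e), pathfinish (\<gamma> e)} = {\<phi> u, \<phi> v}" using ends[OF e] by simp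
    then consider "pathstart (\<gamma> e) = \<phi> u" "pathfinish (\<gamma> e) = \<phi> v" | "pathstart (\<gamma> e) = \<phi> v" "pathfinish (\<gamma> e) = \<phi> u"
      by (auto simp: doubleton_eq_iff)
    then show ?thesis
    proof cases
      case 1
      then have "Q e u v" using uv unfolding Q_def pathstart_def pathfinish_def by simp
      then show ?thesis by blast
    next
      case 2
      then have "Q e v u" using uv unfolding Q_def pathstart_def pathfinish_def by auto
      then show ?thesis by blast
    qed
  qed
  then obtain s t where st: "\<And>e. e \<in> E \<Longrightarrow> Q e (s e) (t e)" by metis
  have stV: "s e \<in> V" "t e \<in> V" "s e \<noteq> t e" "{s e, t e} = e" "\<gamma> e 0 = \<phi> (s e)" "\<gamma> e 1 = \<phi> (t e)"
    if "e \<in> E" for e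
    using st[OF that] unfolding Q_def by simp_all
  have mem: "x \<in> e \<longleftrightarrow> x = s e \<or> x = t e" if "e \<in> E" for x e
    by (subst stV(4)[OF that, symmetric]) simp
  define L where "L e = \<gamma> e ` {0..1/3}" for e
  define M where "M e = \<gamma> e ` {1/3..2/3}" for e
  define R where "R e = \<gamma> e ` {2/3..1}" for e
  have sub: "L e \<subseteq> path_image (\<gamma> e)" "M e \<subseteq> path_image (\<gamma> e)" "R e \<subseteq> path_image (\<gamma> e)" for e
    unfolding L_def M_def R_def path_image_def by auto
  have injg: "inj_on (\<gamma> e) {0..1}" and contg: "continuous_on {0..1} (\<gamma> e)" if "e \<in> E" for e
    using arc[OF that] unfolding arc_def path_def by auto
  have img: "\<gamma> e y \<in> \<gamma> e ` I \<longleftrightarrow> y \<in> I" if "e \<in> E" "y \<in> {0..1}" "I \<subseteq> {0..1}" for e y I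
    by (rule inj_on_image_mem_iff[OF injg[OF that(1)] that(2,3)])
  have far: "\<phi> (t e) \<notin> L e" "\<phi> (s e) \<notin> R e" "\<phi> (s e) \<notin> M e" "\<phi> (t e) \<notin> M e" if "e \<in> E" for e
    using img[OF that, of 0] img[OF that, of 1]
    by (simp_all add: L_def R_def M_def stV(5,6)[OF that, symmetric])
  have cc: "compact (L e)" "connected (L e)" "compact (M e)" "connected (M e)" "compact (R e)" "connected (R e)"
    if "e \<in> E" for e
    unfolding L_def M_def R_def
    using continuous_on_subset[OF contg[OF that]]
    by (auto intro!: compact_continuous_image connected_continuous_image)
  have vL: "x = s e" if "e \<in> E" "x \<in> V" "\<phi> x \<in> L e" for e x
    using vert[OF that(1,2)] sub(1) that(3) mem[OF that(1), of x] far(1)[OF that(1)] by auto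
  have vR: "x = t e" if "e \<in> E" "x \<in> V" "\<phi> x \<in> R e" for e x
    using vert[OF that(1,2)] sub(3) that(3) mem[OF that(1), of x] far(2)[OF that(1)] by auto
  have vM: "\<phi> x \<notin> M e" if "e \<in> E" "x \<in> V" for e x
    using vert[OF that(1,2)] sub(2) mem[OF that(1), of x] far(3,4)[OF that(1)] by auto
  have LR: "L e \<inter> R e = {}" if "e \<in> E" for e
    unfolding L_def R_def using inj_on_image_Int[OF injg[OF that], of "{0..1/3}" "{2/3..1}"] by simp
  have eV: "e \<subseteq> V" if "e \<in> E" for e using stV(1,2)[OF that] mem[OF that] by auto
  have meet: "\<exists>x\<in>V. z = \<phi> x \<and> x \<in> e \<and> x \<in> f" if "e \<in> E" "f \<in> E" "e \<noteq> f" "z \<in> path_image (\<gamma> e)" "z \<in> path_image (\<gamma> f)" for e f z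
    using cross[OF that(1-3)] that(4,5) eV[OF that(1)] by blast
  have XE: "X \<subseteq> E" using X(1) by blast

  have "bounded ((\<Union>e\<in>X. path_image (\<gamma> e)) \<union> \<phi> ` B)"
    using X(2) XE B(2) arc
    by (intro bounded_Un[THEN iffD2] conjI bounded_UN ballI bounded_path_image arc_imp_path
        finite_imp_bounded finite_imageI) auto
  then obtain \<rho> where \<rho>0: "\<rho> > 0" and \<rho>: "\<And>z. z \<in> (\<Union>e\<in>X. path_image (\<gamma> e)) \<union> \<phi> ` B \<Longrightarrow> norm z < \<rho>"
    by (meson bounded_pos_less)
  define W where "W = {u \<in> V - B. \<exists>e\<in>X. u \<in> e}"
  have "finite W"
  proof (rule finite_subset)
    show "W \<subseteq> s ` X \<union> t ` X" unfolding W_def using mem XE by auto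
  qed (use X(2) in simp)
  define QZ where "QZ u Z \<longleftrightarrow> compact Z \<and> connected Z \<and> \<phi> u \<in> Z \<and> Z \<inter> sphere 0 \<rho> \<noteq> {} \<and>
      Z \<subseteq> {\<phi> u} \<union> (\<Union>f\<in>{f \<in> E. f \<subseteq> V - B}. path_image (\<gamma> f))" for u Z
  have "\<exists>Z. QZ u Z" if u: "u \<in> W" for u
  proof -
    have uVB: "u \<in> V - B" using u unfolding W_def by blast
    have "finite {v \<in> V. \<phi> v \<in> cball 0 \<rho>}" 
      by (rule finite_vertices_in_compact[OF compact_cball acc])
    then have "\<not> reach E (V - B) u \<subseteq> {v \<in> V. \<phi> v \<in> cball 0 \<rho>}"
      using inf[OF uVB] finite_subset by blast
    then obtain w where w: "w \<in> reach E (V - B) u" "w \<notin> {v \<in> V. \<phi> v \<in> cball 0 \<rho>}" by blast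
    have uw: "(u, w) \<in> (adj E \<inter> (V - B) \<times> (V - B))\<^sup>*" using w(1) unfolding reach_def by simp
    then have "w \<in> V" using uVB by (auto elim: rtranclE)
    then have nw: "\<rho> \<le> norm (\<phi> w)" using w(2) by auto
    obtain Z where Z: "compact Z" "connected Z" "\<phi> u \<in> Z" "\<phi> w \<in> Z"
      "Z \<subseteq> {\<phi> u} \<union> (\<Union>f\<in>{f \<in> E. f \<subseteq> V - B}. path_image (\<gamma> f))"
      using continuum_along_path[OF rep uw] by blast
    obtain e where e: "e \<in> X" "u \<in> e" using u unfolding W_def by blast
    have eE: "e \<in> E" using e XE by blast
    have "\<phi> u = \<gamma> e 0 \<or> \<phi> u = \<gamma> e 1" using e(2) mem[OF eE] stV(5,6)[OF eE] by auto
    then have "\<phi> u \<in> path_image (\<gamma> e)" unfolding path_image_def by auto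
    then have "\<phi> u \<in> (\<Union>e\<in>X. path_image (\<gamma> e)) \<union> \<phi> ` B" using e(1) by blast
    then have "norm (\<phi> u) \<le> \<rho>" using \<rho> less_imp_le by blast
    then have "Z \<inter> sphere 0 \<rho> \<noteq> {}" by (rule connected_meets_sphere[OF Z(2,3,4) _ nw])
    with Z have "QZ u Z" unfolding QZ_def by simp
    then show ?thesis by blast
  qed
  then obtain Z where "\<And>u. u \<in> W \<Longrightarrow> QZ u (Z u)" by metis
  then have Z: "compact (Z u)" "connected (Z u)" "\<phi> u \<in> Z u" "Z u \<inter> sphere 0 \<rho> \<noteq> {}"
      "Z u \<subseteq> {\<phi> u} \<union> (\<Union>f\<in>{f \<in> E. f \<subseteq> V - B}. path_image (\<gamma> f))" if "u \<in> W" for u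
    using that unfolding QZ_def by simp_all

  define \<nu> where "\<nu> v = (if v \<in> B then Some v else None)" for v
  define a where "a e = \<nu> (s e)" for e
  define b where "b e = \<nu> (t e)" for e
  define Vs where "Vs = insert None (Some ` B)"
  \<comment> \<open>what a vertex consists of besides the outer thirds of its edges\<close>
  define core where "core n = (case n of Some v \<Rightarrow> {\<phi> v} | None \<Rightarrow> sphere 0 \<rho> \<union> (\<Union>u\<in>W. Z u))" for n
  \<comment> \<open>the vertices of the contracted graph as continua; \<open>L\<close> and \<open>R\<close> are the outer thirds of the arcs\<close>
  define K where "K n = core n \<union> ((\<Union>e\<in>{e \<in> X. a e = n}. L e) \<union> (\<Union>e\<in>{e \<in> X. b e = n}. R e))" for n
  have coreE: "(\<exists>v\<in>V. z = \<phi> v \<and> \<nu> v = n)"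
    if z: "z \<in> core n" "n \<in> Vs" "e \<in> X" "z \<in> path_image (\<gamma> e)" for z n e
  proof (cases n)
    case (Some v)
    then have "v \<in> B" using z(2) unfolding Vs_def by auto
    then show ?thesis using z(1) B(1) Some unfolding core_def \<nu>_def by auto
  next
    case None
    have "norm z < \<rho>" using z(3,4) \<rho> by blast
    then obtain u where u: "u \<in> W" "z \<in> Z u" using z(1) unfolding core_def None by auto
    consider "z = \<phi> u" | f where "f \<in> E" "f \<subseteq> V - B" "z \<in> path_image (\<gamma> f)" using Z(5)[OF u(1)] u(2) by blast
    then show ?thesis
    proof cases
      case 1
      then show ?thesis using u(1) None unfolding W_def \<nu>_def by auto
    next
      case 2
      then have "e \<noteq> f" using z(3) X(1) by blast
      then obtain x where "x \<in> V" "z = \<phi> x" "x \<in> f" using meet[of e f z] z(3,4) 2 XE by blast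
      then show ?thesis using 2(2) None unfolding \<nu>_def by auto
    qed
  qed
  have coreB: "core n \<inter> core m = {}" if "n \<in> Vs" "m \<in> Vs" "n \<noteq> m" for n m
  proof -
    have *: "\<phi> v \<notin> core None" if "v \<in> B" for v
    proof
      assume "\<phi> v \<in> core None"
      moreover have "norm (\<phi> v) < \<rho>" using \<rho> that by blast
      ultimately obtain u where u: "u \<in> W" "\<phi> v \<in> Z u" unfolding core_def by auto
      have vV: "v \<in> V" using that B by blast
      consider "\<phi> v = \<phi> u" | f where "f \<in> E" "f \<subseteq> V - B" "\<phi> v \<in> path_image (\<gamma> f)" using Z(5)[OF u(1)] u(2) by blast
      then show False
      proof cases
        case 1
        then have "v = u" using inj vV u(1) unfolding W_def by (auto dest: inj_onD)
        then show ?thesis using u(1) that unfolding W_def by blast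
      next
        case 2
        then show ?thesis using vert[OF 2(1) vV] that by blast
      qed
    qed
    have **: "\<phi> v \<noteq> \<phi> w" if "v \<in> B" "w \<in> B" "v \<noteq> w" for v w
      using inj that B(1) by (auto dest: inj_onD)
    show ?thesis using that * ** unfolding Vs_def core_def by (auto split: option.splits)
  qed
  have piece: "(\<exists>x\<in>V. z = \<phi> x \<and> \<nu> x = n) \<or> (\<exists>e\<in>X. z \<in> L e \<and> a e = n) \<or> (\<exists>e\<in>X. z \<in> R e \<and> b e = n)"
    if "z \<in> K n" "n \<in> Vs" "e \<in> X" "z \<in> path_image (\<gamma> e)" for z n e
    using that coreE[of z n e] unfolding K_def by blast
  have shared: "\<exists>x\<in>V. z = \<phi> x" if "e \<in> X" "f \<in> X" "e \<noteq> f"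
      "z \<in> path_image (\<gamma> e)" "z \<in> path_image (\<gamma> f)" for e f z
    using meet[of e f z] that XE by blast
  have LL: "a e = a f" if ef: "e \<in> X" "f \<in> X" and z: "z \<in> L e" "z \<in> L f" for e f z
  proof (cases "e = f")
    case False
    obtain x where x: "x \<in> V" "z = \<phi> x"
      using shared[OF ef False subsetD[OF sub(1) z(1)] subsetD[OF sub(1) z(2)]] by blast
    have "x = s e" "x = s f" using vL[of e x] vL[of f x] z ef x XE by auto
    then show ?thesis unfolding a_def by simp
  qed simp
  have RR: "b e = b f" if ef: "e \<in> X" "f \<in> X" and z: "z \<in> R e" "z \<in> R f" for e f z
  proof (cases "e = f")
    case False
    obtain x where x: "x \<in> V" "z = \<phi> x"
      using shared[OF ef False subsetD[OF sub(3) z(1)] subsetD[OF sub(3) z(2)]] by blast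
    have "x = t e" "x = t f" using vR[of e x] vR[of f x] z ef x XE by auto
    then show ?thesis unfolding b_def by simp
  qed simp
  have LR': "a e = b f" if ef: "e \<in> X" "f \<in> X" and z: "z \<in> L e" "z \<in> R f" for e f z
  proof (cases "e = f")
    case True
    then show ?thesis using LR[of e] ef z XE by auto
  next
    case False
    obtain x where x: "x \<in> V" "z = \<phi> x"
      using shared[OF ef False subsetD[OF sub(1) z(1)] subsetD[OF sub(3) z(2)]] by blast
    have "x = s e" "x = t f" using vL[of e x] vR[of f x] z ef x XE by auto
    then show ?thesis unfolding a_def b_def by simp
  qed
  have KL: "n = a e" if n: "n \<in> Vs" and e: "e \<in> X" and z: "z \<in> K n" "z \<in> L e" for n e z
  proof -
    have ze: "z \<in> path_image (\<gamma> e)" using sub(1) z(2) by blast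
    from piece[OF z(1) n e ze] consider x where "x \<in> V" "z = \<phi> x" "\<nu> x = n"
      | f where "f \<in> X" "z \<in> L f" "a f = n" | f where "f \<in> X" "z \<in> R f" "b f = n" by blast
    then show ?thesis
    proof cases
      case 1
      then have "x = s e" using vL[of e x] z e XE by auto
      then show ?thesis using 1 unfolding a_def by simp
    next
      case 2
      then show ?thesis using LL[OF e 2(1) z(2) 2(2)] by simp
    next
      case 3
      then show ?thesis using LR'[OF e 3(1) z(2) 3(2)] by simp
    qed
  qed
  have KR: "n = b e" if n: "n \<in> Vs" and e: "e \<in> X" and z: "z \<in> K n" "z \<in> R e" for n e z
  proof -
    have ze: "z \<in> path_image (\<gamma> e)" using sub(3) z(2) by blast
    from piece[OF z(1) n e ze] consider x where "x \<in> V" "z = \<phi> x" "\<nu> x = n"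
      | f where "f \<in> X" "z \<in> L f" "a f = n" | f where "f \<in> X" "z \<in> R f" "b f = n" by blast
    then show ?thesis
    proof cases
      case 1
      then have "x = t e" using vR[of e x] z e XE by auto
      then show ?thesis using 1 unfolding b_def by simp
    next
      case 2
      then show ?thesis using LR'[OF 2(1) e 2(2) z(2)] by simp
    next
      case 3
      then show ?thesis using RR[OF e 3(1) z(2) 3(2)] by simp
    qed
  qed
  have "\<exists>l r :: 'a set \<Rightarrow> int \<times> int. \<forall>P\<subseteq>X.
           (\<exists>T\<subseteq>Vs. P = X \<inter> edge_cut a b T) \<longleftrightarrow> odd_faces l r P = {}"
  proof (rule continuum_dual[where K = K and J = M])
    show "finite Vs" using B(2) unfolding Vs_def by simp
    show "finite X" by fact
    show "compact (M e) \<and> connected (M e)" if "e \<in> X" for e using cc that XE by blast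
    show "compact (K n) \<and> connected (K n)" if n: "n \<in> Vs" for n
    proof
      have "compact (core n)"
        unfolding core_def using Z \<open>finite W\<close> by (auto split: option.splits intro!: compact_Un compact_UN)
      then show "compact (K n)" unfolding K_def using X(2) cc XE by (intro compact_Un compact_UN) auto
      have cn: "connected (core n)"
      proof (cases n)
        case None
        have "connected (sphere (0::real^2) \<rho>)" by (intro connected_sphere) simp
        then show ?thesis unfolding core_def None option.case using Z(2,4) \<rho>0
          by (intro connected_star) (auto simp: Int_commute)
      qed (simp add: core_def)
      have ne: "core n \<noteq> {}" using \<rho>0 unfolding core_def by (auto split: option.splits)
      have in_core: "\<phi> v \<in> core (\<nu> v)" if "e \<in> X" "v \<in> e" for v e
      proof (cases "v \<in> B")
        case False
        then have "v \<in> W" using that eV XE unfolding W_def by blast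
        then show ?thesis using Z(3)[of v] False unfolding core_def \<nu>_def by auto
      qed (simp add: core_def \<nu>_def)
      have cL: "connected (L e) \<and> core n \<inter> L e \<noteq> {}" if e: "e \<in> X" "a e = n" for e
      proof -
        have eE: "e \<in> E" using e XE by blast
        have "\<gamma> e 0 \<in> core n" using in_core[of e "s e"] e mem[OF eE] stV(5)[OF eE] unfolding a_def by auto
        moreover have "\<gamma> e 0 \<in> L e" unfolding L_def by simp
        ultimately show ?thesis using cc(2)[OF eE] by blast
      qed
      have cR: "connected (R e) \<and> core n \<inter> R e \<noteq> {}" if e: "e \<in> X" "b e = n" for e
      proof -
        have eE: "e \<in> E" using e XE by blast
        have "\<gamma> e 1 \<in> core n" using in_core[of e "t e"] e mem[OF eE] stV(6)[OF eE] unfolding b_def by auto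
        moreover have "\<gamma> e 1 \<in> R e" unfolding R_def by simp
        ultimately show ?thesis using cc(6)[OF eE] by blast
      qed
      have "connected (core n \<union> (\<Union>e\<in>{e \<in> X. a e = n}. L e))"
        using cL by (intro connected_star[OF cn ne]) auto
      then have "connected ((core n \<union> (\<Union>e\<in>{e \<in> X. a e = n}. L e)) \<union> (\<Union>e\<in>{e \<in> X. b e = n}. R e))"
        by (rule connected_star) (use cR ne in auto)
      then show "connected (K n)" unfolding K_def by (simp add: Un_assoc)
    qed
    show "K n \<inter> K m = {}" if nm: "n \<in> Vs" "m \<in> Vs" "n \<noteq> m" for n m
    proof (rule ccontr)
      assume "\<not> ?thesis"
      then obtain z where z: "z \<in> K n" "z \<in> K m" by blast
      have nL: "z \<notin> L e" if "e \<in> X" for e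
        using KL[OF nm(1) that z(1)] KL[OF nm(2) that z(2)] nm(3) by auto
      have nR: "z \<notin> R e" if "e \<in> X" for e
        using KR[OF nm(1) that z(1)] KR[OF nm(2) that z(2)] nm(3) by auto
      have "z \<in> core n" "z \<in> core m" using z nL nR unfolding K_def by auto
      then show False using coreB[OF nm] by blast
    qed
    have only_ends: "n = a e \<or> n = b e" if e: "e \<in> X" and n: "n \<in> Vs" and z: "z \<in> M e" "z \<in> K n" for e n z
    proof -
      have eE: "e \<in> E" using e XE by blast
      have ze: "z \<in> path_image (\<gamma> e)" using sub(2) z(1) by blast
      have nv: "z \<noteq> \<phi> x" if "x \<in> V" for x using vM[OF eE that] z(1) by auto
      have self: "f = e" if "f \<in> X" "z \<in> path_image (\<gamma> f)" for f
        using shared[OF e that(1) _ ze that(2)] nv by blast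
      from piece[OF z(2) n e ze] consider x where "x \<in> V" "z = \<phi> x" "\<nu> x = n"
        | f where "f \<in> X" "z \<in> L f" "a f = n" | f where "f \<in> X" "z \<in> R f" "b f = n" by blast
      then show ?thesis
      proof cases
        case 1
        then show ?thesis using nv by blast
      next
        case 2
        then show ?thesis using self[of f] sub(1)[of f] by auto
      next
        case 3
        then show ?thesis using self[of f] sub(3)[of f] by auto
      qed
    qed
    show "M e \<inter> M f = {}" if ef: "e \<in> X" "f \<in> X" "e \<noteq> f" for e f
    proof (rule ccontr)
      assume "\<not> ?thesis"
      then obtain z where z: "z \<in> M e" "z \<in> M f" by blast
      then obtain x where "x \<in> V" "z = \<phi> x"
        using shared[OF ef subsetD[OF sub(2)] subsetD[OF sub(2)]] by blast
      then show False using vM[of e x] z(1) ef(1) XE by auto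
    qed
    show "a e \<in> Vs \<and> b e \<in> Vs \<and> a e \<noteq> b e" if e: "e \<in> X" for e
    proof -
      have eE: "e \<in> E" using that XE by blast
      have "s e \<in> B \<or> t e \<in> B" using e mem[OF eE] unfolding X(1) by auto
      then show ?thesis using stV(3)[OF eE] unfolding a_def b_def \<nu>_def Vs_def by auto
    qed
    show "M e \<inter> K (a e) \<noteq> {} \<and> M e \<inter> K (b e) \<noteq> {}" if e: "e \<in> X" for e
    proof
      have "\<gamma> e (1/3) \<in> M e" "\<gamma> e (1/3) \<in> L e" unfolding M_def L_def by auto
      then show "M e \<inter> K (a e) \<noteq> {}" using e unfolding K_def by blast
      have "\<gamma> e (2/3) \<in> M e" "\<gamma> e (2/3) \<in> R e" unfolding M_def R_def by auto
      then show "M e \<inter> K (b e) \<noteq> {}" using e unfolding K_def by blast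
    qed
    show "M e \<inter> K n = {}" if "e \<in> X" "n \<in> Vs" "n \<noteq> a e" "n \<noteq> b e" for e n
      using only_ends[OF that(1,2)] that(3,4) by blast
  qed
  moreover have cut: "edge_boundary V E T = X \<inter> edge_cut a b (Some ` T)" if T: "T \<subseteq> B" for T
  proof (rule set_eqI)
    fix e
    show "e \<in> edge_boundary V E T \<longleftrightarrow> e \<in> X \<inter> edge_cut a b (Some ` T)"
    proof (cases "e \<in> E")
      case True
      have \<nu>T: "\<nu> v \<in> Some ` T \<longleftrightarrow> v \<in> T" for v using T unfolding \<nu>_def by auto
      note e = stV(4)[OF True]
      have "e \<in> edge_boundary V E T \<longleftrightarrow> (s e \<in> T) \<noteq> (t e \<in> T)"
        using mem_edge_boundary[OF G, of T "s e" "t e"] T B(1) True e by auto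
      also have "\<dots> \<longleftrightarrow> e \<in> edge_cut a b (Some ` T)" unfolding edge_cut_def a_def b_def by (simp add: \<nu>T)
      finally have "e \<in> edge_boundary V E T \<longleftrightarrow> e \<in> edge_cut a b (Some ` T)" .
      moreover have "e \<in> edge_boundary V E T \<Longrightarrow> e \<in> X"
        using edge_boundary_touches[of e V E T] True T unfolding X(1) by blast
      ultimately show ?thesis by blast
    next
      case False
      then show ?thesis using edge_boundary_subset[of V E T] XE by blast
    qed
  qed
  moreover have "(\<exists>T\<subseteq>B. P = edge_boundary V E T) \<longleftrightarrow> (\<exists>T\<subseteq>Vs. P = X \<inter> edge_cut a b T)" for P
  proof
    assume "\<exists>T\<subseteq>B. P = edge_boundary V E T"
    then obtain T where "T \<subseteq> B" "P = edge_boundary V E T" by blast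
    then show "\<exists>T\<subseteq>Vs. P = X \<inter> edge_cut a b T"
      using cut unfolding Vs_def by (intro exI[of _ "Some ` T"]) auto
  next
    assume "\<exists>T\<subseteq>Vs. P = X \<inter> edge_cut a b T"
    then obtain T where T: "T \<subseteq> Vs" "P = X \<inter> edge_cut a b T" by blast
    \<comment> \<open>the side of the cut that does not contain the vertex at infinity\<close>
    define T' where "T' = (if None \<in> T then Vs - T else T)"
    have abV: "a e \<in> Vs" "b e \<in> Vs" for e unfolding a_def b_def \<nu>_def Vs_def by auto
    have "P = X \<inter> edge_cut a b T'" unfolding T(2) T'_def edge_cut_def using abV by auto
    moreover have "T' \<subseteq> Some ` B" using T(1) unfolding T'_def Vs_def by auto
    then obtain S where "S \<subseteq> B" "T' = Some ` S" by (meson subset_imageE)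
    ultimately show "\<exists>T\<subseteq>B. P = edge_boundary V E T" using cut by blast
  qed
  ultimately show ?thesis by simp
qed

section \<open>Counting dual paths\<close>

text \<open>An edge set without nonempty even subset is a forest of the dual graph. If moreover \<open>f \<noteq> g\<close> are
  its only odd faces, it is a path from \<open>f\<close> to \<open>g\<close>.\<close>

definition dual_paths :: "('e \<Rightarrow> 'f) \<Rightarrow> ('e \<Rightarrow> 'f) \<Rightarrow> 'e set \<Rightarrow> 'f \<Rightarrow> 'f \<Rightarrow> nat \<Rightarrow> 'e set set" where
  "dual_paths l r X f g n = {A. A \<subseteq> X \<and> card A = n \<and>
     (\<forall>A'\<subseteq>A. A' \<noteq> {} \<longrightarrow> odd_faces l r A' \<noteq> {}) \<and> odd_faces l r A = sym_diff {f} {g}}"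

lemma dual_pathsD:
  assumes "A \<in> dual_paths l r X f g n"
  shows "A \<subseteq> X" "card A = n" "\<And>A'. A' \<subseteq> A \<Longrightarrow> A' \<noteq> {} \<Longrightarrow> odd_faces l r A' \<noteq> {}"
    "odd_faces l r A = sym_diff {f} {g}"
  using assms unfolding dual_paths_def by simp_all

text \<open>The first \<open>j\<close> edges of the path are found by walking along it: as long as edges remain, the
  face \<open>h\<close> reached so far is odd in the rest, so an edge of the rest leads on from \<open>h\<close>.\<close>

lemma dual_path_split:
  assumes "finite X" "A \<in> dual_paths l r X f g n" "j \<le> n"
  shows "\<exists>h A1. A1 \<subseteq> A \<and> A1 \<in> dual_paths l r X f h j \<and> A - A1 \<in> dual_paths l r X h g (n - j)"
  using assms(3)
proof (induction j)
  case 0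
  have "{} \<in> dual_paths l r X f f 0" unfolding dual_paths_def by simp
  then show ?case using assms(2) by (intro exI[of _ f] exI[of _ "{}"]) simp
next
  case (Suc j)
  note A = dual_pathsD[OF assms(2)]
  obtain h A1 where A1: "A1 \<subseteq> A" "A1 \<in> dual_paths l r X f h j" "A - A1 \<in> dual_paths l r X h g (n - j)"
    using Suc by auto
  have fA: "finite A" by (rule finite_subset[OF A(1) assms(1)])
  note fin = fA finite_subset[OF A1(1) fA]
  have "card (A - A1) = n - j" using dual_pathsD(2)[OF A1(3)] .
  then have "card (A - A1) > 0" using Suc.prems by simp
  then have "A - A1 \<noteq> {}" by (metis card.empty less_irrefl)
  then have odd: "odd_faces l r (A - A1) \<noteq> {}" using A(3)[of "A - A1"] by blast
  then have "h \<in> odd_faces l r (A - A1)" using dual_pathsD(4)[OF A1(3)] by auto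
  then obtain e where e: "e \<in> A - A1" "l e \<noteq> r e" "l e = h \<or> r e = h"
    using odd_faces_incident by metis
  \<comment> \<open>the face at the far end of \<open>e\<close>\<close>
  define h' where "h' = (if l e = h then r e else l e)"
  have eh: "sym_diff {l e} {r e} = sym_diff {h} {h'}" using e(2,3) unfolding h'_def by auto
  have d: "A - insert e A1 = A - A1 - {e}" by blast
  show ?case
  proof (intro exI conjI)
    show sub: "insert e A1 \<subseteq> A" using e A1(1) by blast
    have "odd_faces l r (insert e A1) = sym_diff (sym_diff {f} {h}) (sym_diff {h} {h'})"
      using odd_faces_insert[OF fin(2), of e l r] e(1) eh dual_pathsD(4)[OF A1(2)] by simp
    also have "\<dots> = sym_diff {f} {h'}" by auto
    finally have o1: "odd_faces l r (insert e A1) = sym_diff {f} {h'}" .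
    show "insert e A1 \<in> dual_paths l r X f h' (Suc j)"
      unfolding dual_paths_def mem_Collect_eq
    proof (intro conjI allI impI)
      show "insert e A1 \<subseteq> X" using sub A(1) by blast
      show "card (insert e A1) = Suc j" using e(1) fin dual_pathsD(2)[OF A1(2)] by simp
      show "odd_faces l r A' \<noteq> {}" if "A' \<subseteq> insert e A1" "A' \<noteq> {}" for A'
        using A(3)[of A'] that sub by (meson subset_trans)
    qed (rule o1)
    have "odd_faces l r (A - A1) = sym_diff (odd_faces l r (A - A1 - {e})) (sym_diff {l e} {r e})"
      using odd_faces_insert[of "A - A1 - {e}" e l r] fin e(1) by (simp add: insert_absorb)
    then have "sym_diff {h} {g} = sym_diff (odd_faces l r (A - A1 - {e})) (sym_diff {h} {h'})"
      using dual_pathsD(4)[OF A1(3)] eh by simp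
    then have "odd_faces l r (A - A1 - {e}) = sym_diff (sym_diff {h} {g}) (sym_diff {h} {h'})" by blast
    also have "\<dots> = sym_diff {h'} {g}" by auto
    finally have o2: "odd_faces l r (A - A1 - {e}) = sym_diff {h'} {g}" .
    show "A - insert e A1 \<in> dual_paths l r X h' g (n - Suc j)"
      unfolding dual_paths_def mem_Collect_eq d
    proof (intro conjI allI impI)
      show "A - A1 - {e} \<subseteq> X" using A(1) by blast
      show "card (A - A1 - {e}) = n - Suc j" using e(1) fin dual_pathsD(2)[OF A1(3)] by simp
      show "odd_faces l r A' \<noteq> {}" if "A' \<subseteq> A - A1 - {e}" "A' \<noteq> {}" for A'
        using A(3)[of A'] that by (meson Diff_subset subset_trans)
    qed (rule o2)
  qed
qed

lemma halving_square: "n \<ge> 2 \<Longrightarrow> n\<^sup>2 \<le> 6 * ((n div 2) * (n - n div 2))" for n :: nat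
proof -
  assume n: "n \<ge> 2"
  define j where "j = n div 2"
  have j: "j \<ge> 1" using n unfolding j_def by simp
  have "n = 2 * j \<or> n = 2 * j + 1" unfolding j_def by linarith
  then show ?thesis unfolding j_def[symmetric]
  proof
    assume "n = 2 * j"
    then show "n\<^sup>2 \<le> 6 * (j * (n - j))" by (simp add: power2_eq_square)
  next
    assume "n = 2 * j + 1"
    moreover have "j \<le> j * j" using j by simp
    ultimately show "n\<^sup>2 \<le> 6 * (j * (n - j))" using j by (simp add: power2_eq_square algebra_simps)
  qed
qed

text \<open>Suppose that the dual paths of length \<open>n\<close> with given ends use at most \<open>c * n ^ s\<close> edges
  altogether. Then there are at most \<open>2 * c * n ^ s\<close> possible midpoints, so for the largest number
  \<open>M n\<close> of such paths \<open>M n \<le> 2 * c * n ^ s * M (n div 2) * M (n - n div 2)\<close>. The polynomial factor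
  is harmless because it enters only once for every halving: \<open>\<beta> * n ^ s * M n\<close> is submultiplicative
  along halving for suitable \<open>\<beta>\<close>, whence \<open>M\<close> grows at most exponentially. Counting edge by edge
  would give the useless bound \<open>(c * n ^ s) ^ n\<close>.\<close>

lemma card_dual_paths_le:
  fixes c s :: nat
  assumes fX: "finite X" and c: "c \<ge> 1"
    and near: "\<And>f g n A0. n \<ge> 1 \<Longrightarrow> A0 \<in> dual_paths l r X f g n \<Longrightarrow>
      \<exists>R. finite R \<and> card R \<le> c * n ^ s \<and> \<Union>(dual_paths l r X f g n) \<subseteq> R"
    and n: "n \<ge> 1"
  shows "card (dual_paths l r X f g n) \<le> (4 * c\<^sup>2 * 6 ^ s) ^ n"
proof -
  define q where "q = 2 * c"
  \<comment> \<open>\<open>6 ^ s\<close> makes up for \<open>n\<^sup>2 \<le> 6 * n1 * n2\<close> when \<open>n\<close> is halved\<close>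
  define \<beta> where "\<beta> = q * 6 ^ s"
  define lam where "lam = 4 * c\<^sup>2 * 6 ^ s"
  have q\<beta>: "q * \<beta> = lam" unfolding q_def \<beta>_def lam_def by (simp add: power2_eq_square)
  have \<beta>1: "\<beta> \<ge> 1" using c unfolding \<beta>_def q_def by simp
  have fin: "finite (dual_paths l r X f g n)" for f g n
    by (rule finite_subset[of _ "Pow X"]) (use fX in \<open>auto simp: dual_paths_def\<close>)
  have main: "\<beta> * n ^ s * card (dual_paths l r X f g n) \<le> lam ^ n" if "n \<ge> 1" for n f g
    using that
  proof (induction n arbitrary: f g rule: less_induct)
    case (less n)
    show ?case
    proof (cases "dual_paths l r X f g n = {}")
      case True
      then show ?thesis by simp
    next
      case False
      then obtain A0 where "A0 \<in> dual_paths l r X f g n" by blast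
      from near[OF less.prems this] obtain R where
        R: "finite R" "card R \<le> c * n ^ s" "\<Union>(dual_paths l r X f g n) \<subseteq> R" by blast
      show ?thesis
      proof (cases "n = 1")
        case True
        have "dual_paths l r X f g n \<subseteq> (\<lambda>e. {e}) ` R"
        proof
          fix A assume A: "A \<in> dual_paths l r X f g n"
          then have "card A = 1" using True dual_pathsD(2) by metis
          then obtain e where "A = {e}" by (meson card_1_singletonE)
          then show "A \<in> (\<lambda>e. {e}) ` R" using A R(3) by blast
        qed
        then have "card (dual_paths l r X f g n) \<le> card ((\<lambda>e. {e}) ` R)" using R(1) by (intro card_mono) auto
        also have "\<dots> \<le> c" using card_image_le[OF R(1), of "\<lambda>e. {e}"] R(2) True by simp
        also have "c \<le> q" unfolding q_def by simp
        finally have "\<beta> * card (dual_paths l r X f g n) \<le> \<beta> * q" by (rule mult_left_mono) simp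
        also have "\<beta> * q = lam" using q\<beta> by (simp only: mult.commute)
        finally show ?thesis using True by simp
      next
        case False
        then have n2: "n \<ge> 2" using less.prems by simp
        define n1 where "n1 = n div 2"
        define n2 where "n2 = n - n1"
        have n12: "n1 \<ge> 1" "n2 \<ge> 1" "n1 < n" "n2 < n" "n1 + n2 = n" "n1 \<le> n"
          using n2 unfolding n1_def n2_def by auto
        \<comment> \<open>a midpoint is a face at an edge of the first half, and this edge is in \<open>R\<close>\<close>
        define H where "H = l ` R \<union> r ` R"
        have fH: "finite H" unfolding H_def using R(1) by simp
        have "card H \<le> card (l ` R) + card (r ` R)" unfolding H_def by (rule card_Un_le)
        also have "\<dots> \<le> card R + card R" by (intro add_mono card_image_le R(1))
        also have "\<dots> \<le> q * n ^ s" using R(2) unfolding q_def by simp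
        finally have cH: "card H \<le> q * n ^ s" .
        define D where "D h = dual_paths l r X f h n1 \<times> dual_paths l r X h g n2" for h
        have sub: "dual_paths l r X f g n \<subseteq> (\<Union>h\<in>H. (\<lambda>(A1, A2). A1 \<union> A2) ` D h)"
        proof
          fix A assume A: "A \<in> dual_paths l r X f g n"
          obtain h A1 where h: "A1 \<subseteq> A" "A1 \<in> dual_paths l r X f h n1" "A - A1 \<in> dual_paths l r X h g (n - n1)"
            using dual_path_split[OF fX A n12(6)] by blast
          have "A1 \<noteq> {}" using dual_pathsD(2)[OF h(2)] n12(1) by auto
          then have ne: "odd_faces l r A1 \<noteq> {}" using dual_pathsD(3)[OF h(2)] by blast
          then have "h \<in> odd_faces l r A1" using dual_pathsD(4)[OF h(2)] by auto
          then obtain e where e: "e \<in> A1" "l e = h \<or> r e = h" using odd_faces_incident by metis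
          have "e \<in> R" using e(1) h(1) A R(3) by blast
          then have "h \<in> H" unfolding H_def using e(2) by blast
          moreover have "(A1, A - A1) \<in> D h" using h unfolding D_def n2_def by simp
          moreover have "A = (\<lambda>(A1, A2). A1 \<union> A2) (A1, A - A1)" using h(1) by auto
          ultimately show "A \<in> (\<Union>h\<in>H. (\<lambda>(A1, A2). A1 \<union> A2) ` D h)" by blast
        qed
        have fD: "finite (D h)" for h unfolding D_def using fin by simp
        have each: "(\<beta> * n1 ^ s) * (\<beta> * n2 ^ s) * card (D h) \<le> lam ^ n" for h
        proof -
          have "(\<beta> * n1 ^ s) * (\<beta> * n2 ^ s) * card (D h) =
              (\<beta> * n1 ^ s * card (dual_paths l r X f h n1)) * (\<beta> * n2 ^ s * card (dual_paths l r X h g n2))"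
            unfolding D_def by (simp add: card_cartesian_product)
          also have "\<dots> \<le> lam ^ n1 * lam ^ n2" by (intro mult_mono less.IH n12) simp_all
          finally show ?thesis using n12(5) by (simp add: power_add[symmetric])
        qed
        have "card (dual_paths l r X f g n) \<le> card (\<Union>h\<in>H. (\<lambda>(A1, A2). A1 \<union> A2) ` D h)"
          using fH fD by (intro card_mono sub) auto
        also have "\<dots> \<le> (\<Sum>h\<in>H. card ((\<lambda>(A1, A2). A1 \<union> A2) ` D h))" by (rule card_UN_le[OF fH])
        also have "\<dots> \<le> (\<Sum>h\<in>H. card (D h))" by (intro sum_mono card_image_le fD)
        finally have tot: "card (dual_paths l r X f g n) \<le> (\<Sum>h\<in>H. card (D h))" .
        have sq: "n ^ s * n ^ s \<le> 6 ^ s * (n1 ^ s * n2 ^ s)"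
        proof -
          have "(n\<^sup>2) ^ s \<le> (6 * (n1 * n2)) ^ s"
            using halving_square[OF \<open>n \<ge> 2\<close>] unfolding n1_def n2_def by (intro power_mono) auto
          then show ?thesis by (simp add: power_mult_distrib power2_eq_square)
        qed
        have "q * n ^ s * (\<beta> * n ^ s * card (dual_paths l r X f g n))
            \<le> q * n ^ s * (\<beta> * n ^ s * (\<Sum>h\<in>H. card (D h)))"
          using tot by (intro mult_left_mono) auto
        also have "\<dots> = \<beta> * q * (n ^ s * n ^ s) * (\<Sum>h\<in>H. card (D h))" by (simp add: algebra_simps)
        also have "\<dots> \<le> \<beta> * q * (6 ^ s * (n1 ^ s * n2 ^ s)) * (\<Sum>h\<in>H. card (D h))"
          using sq by (intro mult_right_mono mult_left_mono) auto
        also have "\<dots> = (\<Sum>h\<in>H. (\<beta> * n1 ^ s) * (\<beta> * n2 ^ s) * card (D h))"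
          unfolding sum_distrib_left by (intro sum.cong refl) (simp add: \<beta>_def algebra_simps)
        also have "\<dots> \<le> (\<Sum>h\<in>H. lam ^ n)" by (intro sum_mono each)
        also have "\<dots> = card H * lam ^ n" by simp
        also have "\<dots> \<le> q * n ^ s * lam ^ n" using cH by (rule mult_right_mono) simp
        finally have "q * n ^ s * (\<beta> * n ^ s * card (dual_paths l r X f g n)) \<le> q * n ^ s * lam ^ n" .
        moreover have "q * n ^ s > 0" using c n2 unfolding q_def by simp
        ultimately show ?thesis by simp
      qed
    qed
  qed
  have "1 * card (dual_paths l r X f g n) \<le> \<beta> * n ^ s * card (dual_paths l r X f g n)"
    using \<beta>1 n by (intro mult_right_mono) (auto simp: Suc_le_eq)
  also have "\<dots> \<le> lam ^ n" by (rule main[OF n])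
  finally show ?thesis unfolding lam_def by simp
qed

section \<open>Plane graphs of polynomial growth with an isoperimetric inequality\<close>

lemma relpow_in_superset:
  fixes R S :: "('v \<times> 'v) set"
  shows "(x, y) \<in> R ^^ m \<Longrightarrow> R \<subseteq> S \<Longrightarrow> (x, y) \<in> S ^^ m"
  by (induction m arbitrary: y) auto

lemma sym_adj: "sym (adj E)"
  unfolding adj_def sym_def by (auto simp: insert_commute)

lemma reach_refl [simp]: "x \<in> reach E A x"
  unfolding reach_def by simp

lemma reach_subset: "x \<in> A \<Longrightarrow> reach E A x \<subseteq> A"
  unfolding reach_def by (auto elim: rtranclE)

lemma reach_mono: "A \<subseteq> B \<Longrightarrow> reach E A x \<subseteq> reach E B x"
  unfolding reach_def using rtrancl_mono_restrict[of x _ "adj E" A B] by blast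

lemma reach_step:
  "u \<in> reach E A x \<Longrightarrow> {u, v} \<in> E \<Longrightarrow> u \<in> A \<Longrightarrow> v \<in> A \<Longrightarrow> v \<in> reach E A x"
  unfolding reach_def by (auto simp: adj_def intro: rtrancl_into_rtrancl)

lemma reach_eq:
  assumes "y \<in> reach E A x"
  shows "reach E A y = reach E A x"
proof -
  let ?R = "adj E \<inter> A \<times> A"
  have "sym (?R\<^sup>*)" using sym_adj[of E] by (intro sym_rtrancl) (auto simp: sym_def)
  then have "(x, y) \<in> ?R\<^sup>*" "(y, x) \<in> ?R\<^sup>*" using assms unfolding reach_def by (auto dest: symD)
  then show ?thesis unfolding reach_def by (blast intro: rtrancl_trans)
qed

lemma reach_reach: "reach E A x \<subseteq> reach E (reach E A x) x"
proof
  fix y assume "y \<in> reach E A x"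
  then have "(x, y) \<in> (adj E \<inter> A \<times> A)\<^sup>*" unfolding reach_def by simp
  then show "y \<in> reach E (reach E A x) x"
  proof (induction rule: rtrancl_induct)
    case (step y z)
    have "y \<in> reach E A x" "z \<in> reach E A x"
      using step.hyps unfolding reach_def by (auto intro: rtrancl_into_rtrancl)
    moreover have "{y, z} \<in> E" using step.hyps(2) unfolding adj_def by simp
    ultimately show ?case using reach_step[OF step.IH] by simp
  qed simp
qed

lemma edge_boundary_reach:
  assumes "A \<subseteq> V" "x \<in> A"
  shows "edge_boundary V E (reach E A x) \<subseteq> edge_boundary V E A"
proof
  fix e assume "e \<in> edge_boundary V E (reach E A x)"
  then obtain u v where uv: "e \<in> E" "u \<in> reach E A x" "v \<in> V" "v \<notin> reach E A x" "e = {u, v}"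
    unfolding edge_boundary_def by blast
  have u: "u \<in> A" using uv(2) reach_subset[OF assms(2)] by blast
  then have "v \<notin> A" using reach_step[of u E A x v] uv by blast
  then show "e \<in> edge_boundary V E A" unfolding edge_boundary_def using uv u by blast
qed

locale isoperimetric_plane_graph =
  fixes V :: "'a set" and E :: "'a set set"
    and \<phi> :: "'a \<Rightarrow> real ^ 2" and \<gamma> :: "'a set \<Rightarrow> real \<Rightarrow> real ^ 2" and K D k \<epsilon> :: real
  assumes G: "simple_graph V E"
    and rep: "plane_representation V E \<phi> \<gamma>"
    and acc: "\<And>x. \<not> vertex_accumulation_point V \<phi> x"
    and growth: "\<And>v r. v \<in> V \<Longrightarrow> r \<ge> 1 \<Longrightarrow>
      finite (graph_ball V E v r) \<and> real (card (graph_ball V E v r)) \<le> K * r powr D"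
    and k_pos: "k > 0" and \<epsilon>_pos: "\<epsilon> > 0"
    and iso: "\<And>S. S \<subseteq> V \<Longrightarrow> finite S \<Longrightarrow> S \<noteq> {} \<Longrightarrow>
      real (card (edge_boundary V E S)) \<ge> k * real (card S) powr \<epsilon>"
begin

lemma boundary_finite_nonempty:
  assumes "S \<subseteq> V" "finite S" "S \<noteq> {}"
  shows "finite (edge_boundary V E S)" "edge_boundary V E S \<noteq> {}"
proof -
  have "0 < k * real (card S) powr \<epsilon>" using k_pos assms by simp
  then have "0 < card (edge_boundary V E S)" using iso[OF assms] by linarith
  then show "finite (edge_boundary V E S)" "edge_boundary V E S \<noteq> {}" by (auto simp: card_gt_0_iff)
qed

lemma finite_edges_touching:
  assumes "B \<subseteq> V" "finite B"
  shows "finite {e \<in> E. e \<inter> B \<noteq> {}}"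
proof (rule finite_subset)
  show "{e \<in> E. e \<inter> B \<noteq> {}} \<subseteq> (\<Union>w\<in>B. edge_boundary V E {w})"
  proof
    fix e assume "e \<in> {e \<in> E. e \<inter> B \<noteq> {}}"
    then obtain w where w: "e \<in> E" "w \<in> e" "w \<in> B" by blast
    obtain u v where uv: "u \<in> V" "v \<in> V" "u \<noteq> v" "e = {u, v}" using simple_graphE[OF G w(1)] .
    have "e \<in> edge_boundary V E {w}"
      using uv w(1,2) unfolding edge_boundary_def by (auto simp: insert_commute)
    then show "e \<in> (\<Union>w\<in>B. edge_boundary V E {w})" using w(3) by blast
  qed
  show "finite (\<Union>w\<in>B. edge_boundary V E {w})"
    using assms boundary_finite_nonempty(1)[of "{w}" for w] by (intro finite_UN_I) auto
qed

text \<open>A finite component of the complement of \<open>B0\<close> has nonempty boundary, so it contains one of the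
  finitely many neighbours of \<open>B0\<close>; hence all of them together are a finite set.\<close>

lemma fill_holes:
  assumes B0: "B0 \<subseteq> V" "finite B0"
  shows "\<exists>B. B0 \<subseteq> B \<and> B \<subseteq> V \<and> finite B \<and> (\<forall>u\<in>V - B. infinite (reach E (V - B) u))"
proof -
  define B where "B = B0 \<union> {x \<in> V - B0. finite (reach E (V - B0) x)}"
  define N where "N = \<Union>{e \<in> E. e \<inter> B0 \<noteq> {}}"
  have fN: "finite N" unfolding N_def
  proof (rule finite_Union)
    show "finite {e \<in> E. e \<inter> B0 \<noteq> {}}" by (rule finite_edges_touching[OF B0])
    show "finite e" if "e \<in> {e \<in> E. e \<inter> B0 \<noteq> {}}" for e
    proof -
      have "e \<in> E" using that by simp
      then show ?thesis using simple_graphE[OF G] by (metis finite.emptyI finite.insertI)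
    qed
  qed
  have "B \<subseteq> B0 \<union> (\<Union>u\<in>{u \<in> N. finite (reach E (V - B0) u)}. reach E (V - B0) u)"
  proof
    fix x assume x: "x \<in> B"
    show "x \<in> B0 \<union> (\<Union>u\<in>{u \<in> N. finite (reach E (V - B0) u)}. reach E (V - B0) u)"
    proof (cases "x \<in> B0")
      case False
      let ?C = "reach E (V - B0) x"
      have xV: "x \<in> V - B0" "finite ?C" using x False unfolding B_def by auto
      have CV: "?C \<subseteq> V - B0" by (rule reach_subset[OF xV(1)])
      have "x \<in> ?C" by simp
      then have "?C \<noteq> {}" by blast
      then have "edge_boundary V E ?C \<noteq> {}" using CV xV(2) by (intro boundary_finite_nonempty(2)) auto
      then obtain e u v where e: "e \<in> E" "u \<in> ?C" "v \<in> V" "v \<notin> ?C" "e = {u, v}"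
        unfolding edge_boundary_def by blast
      have "v \<in> B0" using reach_step[of u E "V - B0" x v] e CV by blast
      then have "u \<in> N" unfolding N_def using e by blast
      moreover have "reach E (V - B0) u = ?C" by (rule reach_eq[OF e(2)])
      ultimately show ?thesis using xV(2) \<open>x \<in> ?C\<close> by auto
    qed simp
  qed
  moreover have "finite (B0 \<union> (\<Union>u\<in>{u \<in> N. finite (reach E (V - B0) u)}. reach E (V - B0) u))"
    using fN B0(2) by simp
  ultimately have fB: "finite B" by (rule finite_subset)
  have "infinite (reach E (V - B) u)" if u: "u \<in> V - B" for u
  proof -
    let ?C = "reach E (V - B0) u"
    have inf: "infinite ?C" and u0: "u \<in> V - B0" using u unfolding B_def by auto
    have "?C \<subseteq> V - B"
    proof
      fix y assume y: "y \<in> ?C"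
      then have "infinite (reach E (V - B0) y)" using reach_eq[OF y] inf by simp
      moreover have "y \<in> V - B0" using y reach_subset[OF u0] by blast
      ultimately show "y \<in> V - B" unfolding B_def by blast
    qed
    then have "?C \<subseteq> reach E (V - B) u" by (rule subset_trans[OF reach_reach reach_mono])
    then show ?thesis using inf by (meson finite_subset)
  qed
  then show ?thesis using fB B0 unfolding B_def by (intro exI[of _ B]) (auto simp: B_def)
qed

text \<open>These are the edges that can be connected to \<open>x\<close> by a finite connected set with at most \<open>n\<close>
  boundary edges. By the isoperimetric inequality such a set is of size polynomial in \<open>n\<close>, and by
  polynomial growth so is the number of edges.\<close>

definition nearby :: "'a \<Rightarrow> nat \<Rightarrow> 'a set set" where
  "nearby x n = {e \<in> E. \<exists>T\<subseteq>V. finite T \<and> T \<subseteq> reach E T x \<and> x \<in> T \<and>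
     card (edge_boundary V E T) \<le> n \<and> e \<inter> T \<noteq> {}}"

lemma card_le_of_boundary:
  assumes "T \<subseteq> V" "finite T" "T \<noteq> {}" "card (edge_boundary V E T) \<le> n"
  shows "real (card T) \<le> (n / k) powr (1 / \<epsilon>)"
proof -
  have "k * real (card T) powr \<epsilon> \<le> n" using iso[OF assms(1-3)] assms(4) by linarith
  then have "real (card T) powr \<epsilon> \<le> n / k" using k_pos by (simp add: field_simps)
  then have "(real (card T) powr \<epsilon>) powr (1 / \<epsilon>) \<le> (n / k) powr (1 / \<epsilon>)"
    using \<epsilon>_pos by (intro powr_mono2) auto
  then show ?thesis using \<epsilon>_pos assms by (simp add: powr_powr)
qed

lemma mem_graph_ball:
  assumes "(x, z) \<in> adj E ^^ m" "z \<in> V" "real m < r"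
  shows "z \<in> graph_ball V E x r"
proof -
  have "graph_dist E x z \<le> enat m" unfolding graph_dist_def using assms(1) by (intro INF_lower) simp
  then have "ereal_of_enat (graph_dist E x z) \<le> ereal_of_enat (enat m)"
    by (simp only: ereal_of_enat_le_iff)
  also have "\<dots> < ereal r" using assms(3) by simp
  finally show ?thesis using assms(2) unfolding graph_ball_def by simp
qed

lemma nearby_subset_ball:
  assumes n: "n \<ge> 1"
  shows "nearby x n \<subseteq> (\<lambda>(a, b). {a, b}) ` (graph_ball V E x (((n / k) powr (1 / \<epsilon>))\<^sup>2 + 2) \<times>
       graph_ball V E x (((n / k) powr (1 / \<epsilon>))\<^sup>2 + 2))"
proof
  let ?N = "(n / k) powr (1 / \<epsilon>)"
  let ?B = "graph_ball V E x (?N\<^sup>2 + 2)"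
  fix e assume "e \<in> nearby x n"
  then obtain T where e: "e \<in> E" "e \<inter> T \<noteq> {}" and T: "T \<subseteq> V" "finite T" "T \<subseteq> reach E T x" "x \<in> T"
    "card (edge_boundary V E T) \<le> n" unfolding nearby_def by blast
  have cT: "real (card T) \<le> ?N" using T by (intro card_le_of_boundary) auto
  obtain a b where ab: "a \<in> V" "b \<in> V" "e = {a, b}" using simple_graphE[OF G e(1)] by metis
  then have "a \<in> T \<or> b \<in> T" using e(2) by auto
  then obtain y z where yz: "y \<in> T" "e = {y, z}" "y \<in> V" "z \<in> V"
    using ab insert_commute[of a b "{}"] by metis
  let ?R = "adj E \<inter> T \<times> T"
  have fR: "finite ?R" using T(2) by simp
  have "(x, y) \<in> ?R\<^sup>*" using T(3) yz(1) unfolding reach_def by blast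
  then obtain m where m: "m \<le> card ?R" "(x, y) \<in> ?R ^^ m"
    unfolding rtrancl_finite_eq_relpow[OF fR] by blast
  \<comment> \<open>a crude bound for the distance of \<open>x\<close> and \<open>y\<close> suffices: a power of the size of \<open>T\<close>\<close>
  have "card ?R \<le> card (T \<times> T)" using T(2) by (intro card_mono) auto
  then have "m \<le> (card T)\<^sup>2" using m(1) by (simp add: card_cartesian_product power2_eq_square)
  then have "real m \<le> (real (card T))\<^sup>2" by (metis of_nat_le_iff of_nat_power)
  also have "\<dots> \<le> ?N\<^sup>2" using cT by (intro power_mono) auto
  finally have mN: "real m \<le> ?N\<^sup>2" .
  have xy: "(x, y) \<in> adj E ^^ m" by (rule relpow_in_superset[OF m(2)]) blast
  have "(x, z) \<in> adj E ^^ Suc m" using xy e(1) yz(2) by (auto simp: adj_def)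
  then have "y \<in> ?B" "z \<in> ?B"
    using mem_graph_ball[OF xy yz(3)] mem_graph_ball[OF _ yz(4), of x "Suc m"] mN by auto
  then show "e \<in> (\<lambda>(a, b). {a, b}) ` (?B \<times> ?B)" using yz(2) by blast
qed

lemma nearby_bound:
  "\<exists>c s :: nat. c \<ge> 1 \<and> (\<forall>x\<in>V. \<forall>n\<ge>1. finite (nearby x n) \<and> card (nearby x n) \<le> c * n ^ s)"
proof -
  define D0 where "D0 = max D 0"
  define C where "C = ((1 / k) powr (1 / \<epsilon>))\<^sup>2 + 2"
  define s where "s = nat \<lceil>1 / \<epsilon> * 2 * D0 * 2\<rceil>"
  define c where "c = nat \<lceil>(\<bar>K\<bar> * C powr D0)\<^sup>2\<rceil> + 1"
  have C2: "C \<ge> 2" unfolding C_def by simp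
  have "finite (nearby x n) \<and> card (nearby x n) \<le> c * n ^ s" if x: "x \<in> V" and n: "n \<ge> 1" for x n
  proof -
    define \<rho> where "\<rho> = ((n / k) powr (1 / \<epsilon>))\<^sup>2 + 2"
    have n1: "real n \<ge> 1" using n by simp
    have sq: "(real n powr x)\<^sup>2 = n powr (x * 2)" for x
      by (simp add: power2_eq_square powr_add[symmetric] mult_2_right)
    have "(n / k) powr (1 / \<epsilon>) = n powr (1 / \<epsilon>) * (1 / k) powr (1 / \<epsilon>)"
      using k_pos n by (simp add: powr_mult[symmetric])
    then have "((n / k) powr (1 / \<epsilon>))\<^sup>2 = n powr (1 / \<epsilon> * 2) * ((1 / k) powr (1 / \<epsilon>))\<^sup>2"
      by (simp only: power_mult_distrib sq)
    moreover have "1 \<le> real n powr (1 / \<epsilon> * 2)" using n1 \<epsilon>_pos by (simp add: ge_one_powr_ge_zero)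
    ultimately have \<rho>C: "\<rho> \<le> n powr (1 / \<epsilon> * 2) * C" unfolding \<rho>_def C_def by (simp add: algebra_simps)
    have \<rho>1: "\<rho> \<ge> 1" unfolding \<rho>_def by (simp add: add_increasing)
    let ?B = "graph_ball V E x \<rho>"
    have B: "finite ?B" "real (card ?B) \<le> K * \<rho> powr D" using growth[OF x \<rho>1] by auto
    have "K * \<rho> powr D \<le> \<bar>K\<bar> * \<rho> powr D0"
      unfolding D0_def using \<rho>1 by (intro mult_mono powr_mono) auto
    also have "\<dots> \<le> \<bar>K\<bar> * (n powr (1 / \<epsilon> * 2) * C) powr D0"
      using \<rho>C \<rho>1 unfolding D0_def by (intro mult_left_mono powr_mono2) auto
    also have "\<dots> = (\<bar>K\<bar> * C powr D0) * n powr (1 / \<epsilon> * 2 * D0)"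
      using C2 by (simp add: powr_mult powr_powr)
    finally have cB: "real (card ?B) \<le> (\<bar>K\<bar> * C powr D0) * n powr (1 / \<epsilon> * 2 * D0)" using B(2) by linarith
    have sub: "nearby x n \<subseteq> (\<lambda>(a, b). {a, b}) ` (?B \<times> ?B)"
      using nearby_subset_ball[OF n, of x] unfolding \<rho>_def .
    have fin: "finite (nearby x n)" by (rule finite_subset[OF sub]) (use B(1) in simp)
    have "card (nearby x n) \<le> card ((\<lambda>(a, b). {a, b}) ` (?B \<times> ?B))" using B(1) by (intro card_mono sub) simp
    also have "\<dots> \<le> card (?B \<times> ?B)" using B(1) by (intro card_image_le) simp
    finally have "real (card (nearby x n)) \<le> (real (card ?B))\<^sup>2"
      by (simp add: card_cartesian_product power2_eq_square flip: of_nat_mult)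
    also have "\<dots> \<le> ((\<bar>K\<bar> * C powr D0) * n powr (1 / \<epsilon> * 2 * D0))\<^sup>2" using cB by (intro power_mono) auto
    also have "\<dots> = (\<bar>K\<bar> * C powr D0)\<^sup>2 * n powr (1 / \<epsilon> * 2 * D0 * 2)"
      by (simp only: power_mult_distrib sq)
    also have "\<dots> \<le> real c * real n ^ s"
    proof (intro mult_mono)
      show "(\<bar>K\<bar> * C powr D0)\<^sup>2 \<le> real c" unfolding c_def by linarith
      have "n powr (1 / \<epsilon> * 2 * D0 * 2) \<le> real n powr real s"
        unfolding s_def using n1 by (intro powr_mono) linarith+
      then show "n powr (1 / \<epsilon> * 2 * D0 * 2) \<le> real n ^ s" using n1 by (simp add: powr_realpow)
    qed auto
    finally have "real (card (nearby x n)) \<le> real (c * n ^ s)" by simp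
    then have "card (nearby x n) \<le> c * n ^ s" by (simp only: of_nat_le_iff)
    then show ?thesis using fin by blast
  qed
  moreover have "c \<ge> 1" unfolding c_def by simp
  ultimately show ?thesis by blast
qed

text \<open>This is where geometry enters the counting. Two dual paths \<open>A\<close> and \<open>A0\<close> with the same ends
  together form a closed curve, so their difference is the boundary of a finite set \<open>T\<close>. The
  boundary of a component \<open>T1\<close> of \<open>T\<close> cannot be contained in \<open>A\<close>, which has no even subset, and so
  \<open>T1\<close> connects each edge of \<open>A\<close> on its boundary to an edge of \<open>A0\<close>. Thus \<open>A\<close> stays close to \<open>A0\<close>,
  however long the faces are that the paths jump across.\<close>

lemma dual_paths_nearby:
  assumes B: "B \<subseteq> V" "finite B" and X: "X = {e \<in> E. e \<inter> B \<noteq> {}}"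
    and dual: "\<And>P. P \<subseteq> X \<Longrightarrow> (\<exists>T\<subseteq>B. P = edge_boundary V E T) \<longleftrightarrow> odd_faces l r P = {}"
    and A0: "A0 \<in> dual_paths l r X f g n" and A: "A \<in> dual_paths l r X f g n" and e: "e \<in> A"
  shows "e \<in> A0 \<union> (\<Union>x\<in>\<Union>A0. nearby x (2 * n))"
proof (cases "e \<in> A0")
  case False
  have fX: "finite X" unfolding X by (rule finite_edges_touching[OF B])
  note a0 = dual_pathsD[OF A0] and a = dual_pathsD[OF A]
  note fin = finite_subset[OF a0(1) fX] finite_subset[OF a(1) fX]
  have odd: "odd_faces l r (sym_diff A A0) = {}" using odd_faces_sym_diff[OF fin(2,1), of l r] a0(4) a(4) by simp
  have sX: "sym_diff A A0 \<subseteq> X" using a0(1) a(1) by blast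
  from iffD2[OF dual[OF sX] odd] obtain T where T: "T \<subseteq> B" "sym_diff A A0 = edge_boundary V E T"
    by (elim exE conjE)
  have eT: "e \<in> edge_boundary V E T" using e False T(2) by blast
  note fT = finite_subset[OF T(1) B(2)] subset_trans[OF T(1) B(1)]
  obtain x where x: "x \<in> T" "x \<in> e" using edge_boundary_touches[OF eT] by blast
  define T1 where "T1 = reach E T x"
  have T1: "T1 \<subseteq> T" unfolding T1_def by (rule reach_subset[OF x(1)])
  have x1: "x \<in> T1" unfolding T1_def by simp
  note T1V = subset_trans[OF T1 fT(2)] finite_subset[OF T1 fT(1)] subset_trans[OF T1 T(1)]
  have bT1: "edge_boundary V E T1 \<subseteq> sym_diff A A0"
    unfolding T1_def T(2) by (rule edge_boundary_reach[OF fT(2) x(1)])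
  have neT1: "edge_boundary V E T1 \<noteq> {}" using boundary_finite_nonempty(2)[OF T1V(1,2)] x1 by blast
  have "edge_boundary V E T1 \<inter> A0 \<noteq> {}"
  proof
    assume "edge_boundary V E T1 \<inter> A0 = {}"
    then have sub: "edge_boundary V E T1 \<subseteq> A" using bT1 by blast
    then have "edge_boundary V E T1 \<subseteq> X" using a(1) by blast
    then have "odd_faces l r (edge_boundary V E T1) = {}" by (rule iffD1[OF dual]) (use T1V(3) in blast)
    then show False using a(3)[OF sub neT1] by blast
  qed
  then obtain e0 where e0: "e0 \<in> edge_boundary V E T1" "e0 \<in> A0" by blast
  obtain x0 where x0: "x0 \<in> e0" "x0 \<in> T1" using edge_boundary_touches[OF e0(1)] by blast
  have "card (edge_boundary V E T1) \<le> card (A \<union> A0)" using bT1 fin by (intro card_mono) auto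
  also have "\<dots> \<le> 2 * n" using card_Un_le[of A A0] a(2) a0(2) by simp
  finally have cb: "card (edge_boundary V E T1) \<le> 2 * n" .
  have eq: "reach E T x0 = T1" using reach_eq x0(2) unfolding T1_def by metis
  have "e \<in> nearby x0 (2 * n)" unfolding nearby_def
  proof (intro CollectI conjI exI[of _ T1])
    show "e \<in> E" using e a(1) unfolding X by blast
    show "T1 \<subseteq> reach E T1 x0" using reach_reach[of E T x0] unfolding eq .
    show "e \<inter> T1 \<noteq> {}" using x x1 by blast
  qed (use T1V x0 cb in auto)
  then show ?thesis using x0 e0 by blast
qed simp

section \<open>Bonds around a vertex\<close>

text \<open>The minimal cuts that separate \<open>v\<close> from infinity; minimality is with respect to all boundaries of
  finite sets, whether they contain \<open>v\<close> or not.\<close>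

definition bond :: "'a \<Rightarrow> 'a set set \<Rightarrow> bool" where
  "bond v F \<longleftrightarrow> (\<exists>S\<subseteq>V. finite S \<and> v \<in> S \<and> F = edge_boundary V E S) \<and>
     (\<forall>T\<subseteq>V. finite T \<longrightarrow> T \<noteq> {} \<longrightarrow> edge_boundary V E T \<subseteq> F \<longrightarrow> edge_boundary V E T = F)"

text \<open>Every component of \<open>S\<close> has its boundary within that of \<open>S\<close>, so by minimality the component of \<open>v\<close>
  has the same boundary as \<open>S\<close>.\<close>

lemma bond_connected:
  assumes "bond v F"
  shows "\<exists>T\<subseteq>V. finite T \<and> v \<in> T \<and> T \<subseteq> reach E T v \<and> edge_boundary V E T = F"
proof -
  obtain S where S: "S \<subseteq> V" "finite S" "v \<in> S" "F = edge_boundary V E S"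
    using assms unfolding bond_def by blast
  let ?T = "reach E S v"
  have sub: "?T \<subseteq> S" by (rule reach_subset[OF S(3)])
  note T = subset_trans[OF sub S(1)] finite_subset[OF sub S(2)]
  have "edge_boundary V E ?T \<subseteq> F" unfolding S(4) by (rule edge_boundary_reach[OF S(1,3)])
  moreover have "v \<in> ?T" by simp
  ultimately have "edge_boundary V E ?T = F" using assms T unfolding bond_def by blast
  then show ?thesis using T reach_reach[of E S v] by (intro exI[of _ ?T]) simp
qed

lemma bond_nearby:
  assumes "bond v F" "card F = m"
  shows "F \<subseteq> nearby v m" "F \<noteq> {}"
proof -
  obtain T where T: "T \<subseteq> V" "finite T" "v \<in> T" "T \<subseteq> reach E T v" "edge_boundary V E T = F"
    using bond_connected[OF assms(1)] by blast
  show "F \<subseteq> nearby v m"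
  proof
    fix e assume e: "e \<in> F"
    then have "e \<in> E" "e \<inter> T \<noteq> {}" using T(5) edge_boundary_touches edge_boundary_subset by blast+
    then show "e \<in> nearby v m" unfolding nearby_def using T assms(2) by blast
  qed
  show "F \<noteq> {}" using boundary_finite_nonempty(2)[OF T(1,2)] T(3,5) by blast
qed

text \<open>In the dual graph a bond is a simple cycle: it is even, and by minimality no proper nonempty
  subset is even. Without one of its edges \<open>e\<close> it is a dual path between the two faces of \<open>e\<close>. There
  are exponentially many of these, and polynomially many choices for \<open>e\<close> as a bond around \<open>v\<close> is
  near \<open>v\<close>. The finite part \<open>B\<close> of the graph whose dual is used depends on \<open>v\<close> and \<open>m\<close>, but the
  bound does not.\<close>

lemma card_bonds_le:
  "\<exists>L::nat. \<forall>v\<in>V. \<forall>m\<ge>1. finite {F. bond v F \<and> card F = m} \<and> card {F. bond v F \<and> card F = m} \<le> L ^ m"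
proof -
  obtain c s :: nat where c: "c \<ge> 1"
    and near: "\<And>x n. x \<in> V \<Longrightarrow> n \<ge> 1 \<Longrightarrow> finite (nearby x n) \<and> card (nearby x n) \<le> c * n ^ s"
    using nearby_bound by blast
  \<comment> \<open>the edges of the given path \<open>A0\<close> and those near its at most \<open>2 * n\<close> endpoints\<close>
  define c' where "c' = 1 + 2 * c * 2 ^ s"
  define lam where "lam = 4 * c'\<^sup>2 * 6 ^ Suc s"
  have lam1: "lam \<ge> 1" unfolding lam_def c'_def by simp
  define L where "L = c * 2 ^ s * lam"
  have "finite {F. bond v F \<and> card F = m} \<and> card {F. bond v F \<and> card F = m} \<le> L ^ m"
    if v: "v \<in> V" and m: "m \<ge> 1" for v m
  proof -
    let ?F = "{F. bond v F \<and> card F = m}"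
    have nv: "finite (nearby v m)" "card (nearby v m) \<le> c * m ^ s" using near[OF v m] by auto
    have "?F \<subseteq> Pow (nearby v m)" using bond_nearby(1) by blast
    then have fF: "finite ?F" by (rule finite_subset) (use nv(1) in simp)
    define Q where "Q F T \<longleftrightarrow> T \<subseteq> V \<and> finite T \<and> v \<in> T \<and> edge_boundary V E T = F" for F T
    have "\<exists>T. Q F T" if "F \<in> ?F" for F using bond_connected[of v F] that unfolding Q_def by blast
    then obtain T where T: "\<And>F. F \<in> ?F \<Longrightarrow> Q F (T F)" by metis
    have "(\<Union>F\<in>?F. T F) \<subseteq> V" "finite (\<Union>F\<in>?F. T F)" using T fF unfolding Q_def by blast+
    from fill_holes[OF this] obtain B where B: "(\<Union>F\<in>?F. T F) \<subseteq> B" "B \<subseteq> V" "finite B"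
      "\<And>u. u \<in> V - B \<Longrightarrow> infinite (reach E (V - B) u)" by blast
    define X where "X = {e \<in> E. e \<inter> B \<noteq> {}}"
    have fX: "finite X" unfolding X_def by (rule finite_edges_touching[OF B(2,3)])
    have "\<exists>l r :: 'a set \<Rightarrow> int \<times> int. \<forall>P\<subseteq>X.
        (\<exists>T\<subseteq>B. P = edge_boundary V E T) \<longleftrightarrow> odd_faces l r P = {}"
      by (rule boundary_dual[OF G rep acc B(2,3) X_def fX]) (rule B(4))
    then obtain l r :: "'a set \<Rightarrow> int \<times> int" where
      dual0: "\<forall>P\<subseteq>X. (\<exists>T\<subseteq>B. P = edge_boundary V E T) \<longleftrightarrow> odd_faces l r P = {}"
      by (elim exE that)
    note dual = dual0[rule_format]
    have paths: "card (dual_paths l r X f g n) \<le> lam ^ n" if n: "n \<ge> 1" for f g n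
      unfolding lam_def
    proof (rule card_dual_paths_le[OF fX _ _ n])
      show "c' \<ge> 1" unfolding c'_def by simp
      fix f g and n :: nat and A0
      assume n: "n \<ge> 1" and A0: "A0 \<in> dual_paths l r X f g n"
      let ?R = "A0 \<union> (\<Union>x\<in>\<Union>A0. nearby x (2 * n))"
      have a0: "A0 \<subseteq> X" "card A0 = n" using dual_pathsD[OF A0] by simp_all
      note fA0 = finite_subset[OF a0(1) fX]
      have two: "finite e \<and> card e \<le> 2 \<and> e \<subseteq> V" if "e \<in> A0" for e
      proof -
        have "e \<in> E" using that a0(1) unfolding X_def by blast
        then obtain u w where "u \<in> V" "w \<in> V" "e = {u, w}" using simple_graphE[OF G] by metis
        then show ?thesis by (auto simp: card_insert_if)
      qed
      have fU: "finite (\<Union>A0)" using fA0 two by blast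
      have "card (\<Union>A0) \<le> (\<Sum>e\<in>A0. card e)" by (rule card_Union_le_sum_card)
      also have "\<dots> \<le> (\<Sum>e\<in>A0. 2)" using two by (intro sum_mono) auto
      finally have cU: "card (\<Union>A0) \<le> 2 * n" using a0(2) by simp
      have nr: "finite (nearby x (2 * n))" "card (nearby x (2 * n)) \<le> c * (2 * n) ^ s" if "x \<in> \<Union>A0" for x
        using near[of x "2 * n"] that two n by auto
      have "card ?R \<le> card A0 + card (\<Union>x\<in>\<Union>A0. nearby x (2 * n))" by (rule card_Un_le)
      also have "card (\<Union>x\<in>\<Union>A0. nearby x (2 * n)) \<le> (\<Sum>x\<in>\<Union>A0. card (nearby x (2 * n)))"
        by (rule card_UN_le[OF fU])
      also have "\<dots> \<le> (\<Sum>x\<in>\<Union>A0. c * (2 * n) ^ s)" using nr(2) by (rule sum_mono)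
      also have "\<dots> \<le> 2 * n * (c * (2 * n) ^ s)" using cU by (simp add: mult_right_mono del: mult_le_cancel2)
      also have "card A0 \<le> n ^ Suc s" using a0(2) n by simp
      finally have "card ?R \<le> c' * n ^ Suc s"
        unfolding c'_def by (simp add: algebra_simps power_mult_distrib)
      moreover have "finite ?R" using fA0 fU nr(1) by blast
      moreover have "\<Union>(dual_paths l r X f g n) \<subseteq> ?R"
        using dual_paths_nearby[OF B(2,3) X_def dual A0] by blast
      ultimately show "\<exists>R. finite R \<and> card R \<le> c' * n ^ Suc s \<and> \<Union>(dual_paths l r X f g n) \<subseteq> R" by blast
    qed
    have FX: "F \<subseteq> X" "odd_faces l r F = {}" if F: "F \<in> ?F" for F
    proof -
      have TF: "edge_boundary V E (T F) = F" "T F \<subseteq> B" using T[OF F] B(1) F unfolding Q_def by blast+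
      show "F \<subseteq> X"
      proof
        fix e assume "e \<in> F"
        then have "e \<in> edge_boundary V E (T F)" using TF(1) by simp
        then show "e \<in> X" unfolding X_def
          using edge_boundary_touches[of e V E "T F"] edge_boundary_subset[of V E "T F"] TF(2) by blast
      qed
      then show "odd_faces l r F = {}" using dual[of F] TF by metis
    qed
    have proper: "odd_faces l r A' \<noteq> {}" if F: "F \<in> ?F" and A': "A' \<subset> F" "A' \<noteq> {}" for F A'
    proof
      assume odd: "odd_faces l r A' = {}"
      have A'X: "A' \<subseteq> X" using FX(1)[OF F] A'(1) by blast
      from iffD2[OF dual[OF A'X] odd] obtain S where S: "S \<subseteq> B" "A' = edge_boundary V E S"
        by (elim exE conjE)
      have "S \<noteq> {}" using S(2) A'(2) unfolding edge_boundary_def by auto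
      moreover have "S \<subseteq> V" "finite S"
        by (rule subset_trans[OF S(1) B(2)], rule finite_subset[OF S(1) B(3)])
      ultimately have "edge_boundary V E S = F" using F A'(1) S(2) unfolding bond_def by blast
      then show False using S(2) A'(1) by blast
    qed
    have through: "card {F \<in> ?F. e \<in> F} \<le> lam ^ m" for e
    proof (cases "m = 1")
      case True
      have "{F \<in> ?F. e \<in> F} \<subseteq> {{e}}"
      proof
        fix F assume F: "F \<in> {F \<in> ?F. e \<in> F}"
        then have "card F = 1" using True by simp
        then obtain d where "F = {d}" by (meson card_1_singletonE)
        then show "F \<in> {{e}}" using F by simp
      qed
      then have "card {F \<in> ?F. e \<in> F} \<le> card {{e}}" by (intro card_mono) auto
      also have "\<dots> = 1" by simp
      also have "1 \<le> lam ^ m" using lam1 by (rule one_le_power)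
      finally show ?thesis .
    next
      case False
      have im: "(\<lambda>F. F - {e}) ` {F \<in> ?F. e \<in> F} \<subseteq> dual_paths l r X (l e) (r e) (m - 1)"
      proof (rule image_subsetI)
        fix F assume "F \<in> {F \<in> ?F. e \<in> F}"
        then have F: "F \<in> ?F" and e: "e \<in> F" by auto
        note fF' = finite_subset[OF FX(1)[OF F] fX]
        have "odd_faces l r F = sym_diff (odd_faces l r (F - {e})) (sym_diff {l e} {r e})"
          using odd_faces_insert[of "F - {e}" e l r] fF' e by (simp add: insert_absorb)
        then have o: "odd_faces l r (F - {e}) = sym_diff {l e} {r e}" using FX(2)[OF F] by blast
        show "F - {e} \<in> dual_paths l r X (l e) (r e) (m - 1)"
          unfolding dual_paths_def mem_Collect_eq
        proof (intro conjI allI impI)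
          show "F - {e} \<subseteq> X" using FX(1)[OF F] by blast
          show "card (F - {e}) = m - 1" using F e fF' by simp
          show "odd_faces l r A' \<noteq> {}" if "A' \<subseteq> F - {e}" "A' \<noteq> {}" for A'
            using that e by (intro proper[OF F]) auto
        qed (rule o)
      qed
      have "inj_on (\<lambda>F. F - {e}) {F \<in> ?F. e \<in> F}" by (rule inj_onI) blast
      then have "card {F \<in> ?F. e \<in> F} = card ((\<lambda>F. F - {e}) ` {F \<in> ?F. e \<in> F})" by (simp add: card_image)
      also have "\<dots> \<le> card (dual_paths l r X (l e) (r e) (m - 1))"
        using im by (intro card_mono) (auto intro!: finite_subset[of _ "Pow X"] simp: fX dual_paths_def)
      also have "\<dots> \<le> lam ^ (m - 1)" using False m by (intro paths) simp
      also have "\<dots> \<le> lam ^ m" using lam1 by (intro power_increasing) auto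
      finally show ?thesis .
    qed
    have "?F \<subseteq> (\<Union>e\<in>nearby v m. {F \<in> ?F. e \<in> F})"
    proof
      fix F assume F: "F \<in> ?F"
      then obtain e where "e \<in> F" "e \<in> nearby v m" using bond_nearby[of v F m] by auto
      then show "F \<in> (\<Union>e\<in>nearby v m. {F \<in> ?F. e \<in> F})" using F by auto
    qed
    then have "card ?F \<le> card (\<Union>e\<in>nearby v m. {F \<in> ?F. e \<in> F})"
      by (rule card_mono[rotated]) (rule finite_UN_I[OF nv(1) finite_subset[OF _ fF]], blast)
    also have "\<dots> \<le> (\<Sum>e\<in>nearby v m. card {F \<in> ?F. e \<in> F})" by (rule card_UN_le[OF nv(1)])
    also have "\<dots> \<le> (\<Sum>e\<in>nearby v m. lam ^ m)" by (intro sum_mono through)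
    also have "\<dots> \<le> c * m ^ s * lam ^ m" using nv(2) by (simp add: mult_right_mono del: mult_le_cancel2)
    also have "\<dots> \<le> c ^ m * (2 ^ s) ^ m * lam ^ m"
    proof (intro mult_right_mono mult_mono)
      show "c \<le> c ^ m" using c m by (simp add: self_le_power)
      have "m \<le> 2 ^ m" using less_exp[of m] by simp
      then have "m ^ s \<le> (2 ^ m) ^ s" by (rule power_mono) simp
      then show "m ^ s \<le> (2 ^ s) ^ m" by (simp add: power_mult[symmetric] mult.commute)
    qed auto
    also have "\<dots> = L ^ m" unfolding L_def by (simp add: power_mult_distrib)
    finally show ?thesis using fF by blast
  qed
  then show ?thesis by blast
qed

end

section \<open>Percolation\<close>

lemma pred_Bex_countable:
  assumes "countable I" "\<And>i. i \<in> I \<Longrightarrow> Measurable.pred M (Q i)"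
  shows "Measurable.pred M (\<lambda>x. \<exists>i\<in>I. Q i x)"
proof -
  have "{x \<in> space M. \<exists>i\<in>I. Q i x} = (\<Union>i\<in>I. {x \<in> space M. Q i x})" by auto
  also have "\<dots> \<in> sets M" using assms(2) unfolding pred_def by (intro sets.countable_UN' assms(1)) auto
  finally show ?thesis unfolding pred_def .
qed

lemma pred_Ball_countable:
  assumes "countable I" "\<And>i. i \<in> I \<Longrightarrow> Measurable.pred M (Q i)"
  shows "Measurable.pred M (\<lambda>x. \<forall>i\<in>I. Q i x)"
proof -
  have "Measurable.pred M (\<lambda>x. \<not> (\<exists>i\<in>I. \<not> Q i x))"
    by (intro pred_intros_logic pred_Bex_countable assms)
  then show ?thesis by simp
qed

lemma sets_percolation_coordinate:
  assumes "e \<in> E"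
  shows "Measurable.pred (percolation E p) (\<lambda>\<omega>. \<omega> e)"
proof -
  have "(\<lambda>\<omega>. \<omega> e) \<in> percolation E p \<rightarrow>\<^sub>M measure_pmf (bernoulli_pmf p)"
    unfolding percolation_def by (rule measurable_component_singleton[OF assms])
  then show ?thesis by (simp add: measurable_cong_sets[OF refl sets_measure_pmf_count_space])
qed

lemma space_percolation: "space (percolation E p) = (\<Pi>\<^sub>E e\<in>E. UNIV)"
  unfolding percolation_def space_PiM by simp

lemma prob_space_percolation: "prob_space (percolation E p)"
  unfolding percolation_def by (intro prob_space_PiM measure_pmf.prob_space_axioms)

lemma prob_all_closed:
  assumes F: "finite F" "F \<subseteq> E" and p: "0 \<le> p" "p \<le> 1"
  shows "measure (percolation E p) {\<omega> \<in> space (percolation E p). \<forall>e\<in>F. \<not> \<omega> e} = (1 - p) ^ card F"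
proof -
  let ?M = "\<lambda>_::'a set. measure_pmf (bernoulli_pmf p)"
  interpret product_prob_space ?M E
    by (intro product_prob_spaceI measure_pmf.prob_space_axioms)
  have "restrict \<omega> F \<in> (\<Pi>\<^sub>E e\<in>F. {False}) \<longleftrightarrow> (\<forall>e\<in>F. \<not> \<omega> e)" for \<omega> :: "'a set \<Rightarrow> bool"
    unfolding restrict_PiE_iff by simp
  then have "{\<omega> \<in> space (percolation E p). \<forall>e\<in>F. \<not> \<omega> e} = prod_emb E ?M F (\<Pi>\<^sub>E e\<in>F. {False})"
    unfolding space_percolation prod_emb_def by (simp only: space_measure_pmf) blast
  then have "emeasure (percolation E p) {\<omega> \<in> space (percolation E p). \<forall>e\<in>F. \<not> \<omega> e} =
      (\<Prod>e\<in>F. emeasure (?M e) {False})"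
    unfolding percolation_def using F emeasure_PiM_emb[of F "\<lambda>_. {False}"] by simp
  also have "\<dots> = ennreal ((1 - p) ^ card F)"
    using p by (simp add: emeasure_pmf_single ennreal_power)
  finally show ?thesis using p by (simp add: measure_def)
qed

lemma edge_boundary_cluster_closed:
  assumes "e \<in> edge_boundary V E (cluster V E \<omega> v)"
  shows "\<not> \<omega> e"
proof
  assume "\<omega> e"
  obtain u w where uw: "e \<in> E" "u \<in> cluster V E \<omega> v" "w \<in> V" "w \<notin> cluster V E \<omega> v" "e = {u, w}"
    using assms unfolding edge_boundary_def by blast
  then have "(u, w) \<in> adj (open_edges E \<omega>)" using \<open>\<omega> e\<close> unfolding adj_def open_edges_def by simp
  then have "w \<in> cluster V E \<omega> v"
    using uw(2,3) unfolding cluster_def by (auto intro: rtrancl_into_rtrancl)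
  then show False using uw(4) by simp
qed

context isoperimetric_plane_graph
begin

lemma countable_vertices: "countable V"
proof -
  have "V \<subseteq> (\<Union>n::nat. {v \<in> V. \<phi> v \<in> cball 0 (real n)})"
    using real_arch_simple by (auto simp: dist_norm)
  moreover have "countable (\<Union>n::nat. {v \<in> V. \<phi> v \<in> cball 0 (real n)})"
    by (rule countable_UN[OF countableI_type])
       (rule countable_finite[OF finite_vertices_in_compact[OF compact_cball acc]])
  ultimately show ?thesis by (rule countable_subset)
qed

lemma countable_edges: "countable E"
proof -
  have "E \<subseteq> (\<lambda>(u, v). {u, v}) ` (V \<times> V)" using simple_graphE[OF G] by (auto elim!: simple_graphE[OF G])
  then show ?thesis by (rule countable_subset) (use countable_vertices in simp)
qed

lemma infinite_cluster_event_measurable: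
  "infinite_cluster_event V E \<in> sets (percolation E p)"
proof -
  let ?M = "percolation E p"
  have step: "Measurable.pred ?M (\<lambda>\<omega>. (u, w) \<in> adj (open_edges E \<omega>))" for u w
  proof (cases "{u, w} \<in> E")
    case True
    then show ?thesis
      using sets_percolation_coordinate[OF True] by (simp add: adj_def open_edges_def)
  qed (simp add: adj_def open_edges_def)
  have inV: "u \<in> V" if "(u, w) \<in> adj (open_edges E \<omega>)" for u w \<omega>
  proof -
    have "{u, w} \<in> E" using that unfolding adj_def open_edges_def by simp
    then obtain a b where "a \<in> V" "b \<in> V" "{u, w} = {a, b}" using simple_graphE[OF G] by metis
    then show ?thesis by (auto simp: doubleton_eq_iff)
  qed
  have pow: "Measurable.pred ?M (\<lambda>\<omega>. (v, w) \<in> adj (open_edges E \<omega>) ^^ n)" for v w n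
  proof (induction n arbitrary: w)
    case 0
    show ?case by simp
  next
    case (Suc n)
    have "(v, w) \<in> adj (open_edges E \<omega>) ^^ Suc n \<longleftrightarrow>
        (\<exists>z\<in>V. (v, z) \<in> adj (open_edges E \<omega>) ^^ n \<and> (z, w) \<in> adj (open_edges E \<omega>))" for \<omega>
      using inV by (auto simp: relcomp_unfold)
    moreover have "Measurable.pred ?M (\<lambda>\<omega>. \<exists>z\<in>V.
        (v, z) \<in> adj (open_edges E \<omega>) ^^ n \<and> (z, w) \<in> adj (open_edges E \<omega>))"
      by (intro pred_Bex_countable countable_vertices pred_intros_logic Suc step)
    ultimately show ?case by (simp only:)
  qed
  have conn: "Measurable.pred ?M (\<lambda>\<omega>. w \<in> cluster V E \<omega> v)" for v w
    unfolding cluster_def mem_Collect_eq rtrancl_power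
    using pow by (intro pred_intros_logic pred_intros_countable) auto
  have inf: "infinite (cluster V E \<omega> v) \<longleftrightarrow>
      (\<forall>F\<in>{F. finite F \<and> F \<subseteq> V}. \<exists>w\<in>V - F. w \<in> cluster V E \<omega> v)" for \<omega> v
  proof
    assume i: "infinite (cluster V E \<omega> v)"
    show "\<forall>F\<in>{F. finite F \<and> F \<subseteq> V}. \<exists>w\<in>V - F. w \<in> cluster V E \<omega> v"
    proof
      fix F assume "F \<in> {F. finite F \<and> F \<subseteq> V}"
      then have "\<not> cluster V E \<omega> v \<subseteq> F" using i finite_subset by auto
      then show "\<exists>w\<in>V - F. w \<in> cluster V E \<omega> v" unfolding cluster_def by auto
    qed
  next
    assume a: "\<forall>F\<in>{F. finite F \<and> F \<subseteq> V}. \<exists>w\<in>V - F. w \<in> cluster V E \<omega> v"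
    show "infinite (cluster V E \<omega> v)"
    proof
      assume "finite (cluster V E \<omega> v)"
      then have "cluster V E \<omega> v \<in> {F. finite F \<and> F \<subseteq> V}" by (simp add: cluster_def)
      from bspec[OF a this] show False by blast
    qed
  qed
  have "Measurable.pred ?M (\<lambda>\<omega>. \<exists>v\<in>V. infinite (cluster V E \<omega> v))"
    unfolding inf
    by (intro pred_Bex_countable pred_Ball_countable countable_vertices conn
          countable_Collect_finite_subset countable_Diff)
  then show ?thesis
    unfolding infinite_cluster_event_def by (simp add: pred_def space_percolation)
qed

text \<open>Among the finite sets around \<open>v\<close> with closed boundary let \<open>S\<close> be one with the smallest boundary.
  This boundary is a bond: if that of \<open>T\<close> were a proper part of it, then \<open>T\<close> or the symmetric
  difference of \<open>S\<close> and \<open>T\<close>, whichever contains \<open>v\<close>, would be a set around \<open>v\<close> with closed and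
  smaller boundary.\<close>

lemma closed_bond_around_finite_cluster:
  assumes v: "v \<in> V" and fin: "finite (cluster V E \<omega> v)"
  shows "\<exists>F. bond v F \<and> (\<forall>e\<in>F. \<not> \<omega> e)"
proof -
  define P where "P S \<longleftrightarrow> S \<subseteq> V \<and> finite S \<and> v \<in> S \<and> (\<forall>e\<in>edge_boundary V E S. \<not> \<omega> e)" for S
  have "P (cluster V E \<omega> v)"
    unfolding P_def
  proof (intro conjI ballI)
    show "cluster V E \<omega> v \<subseteq> V" "v \<in> cluster V E \<omega> v" using v unfolding cluster_def by auto
    show "\<not> \<omega> e" if "e \<in> edge_boundary V E (cluster V E \<omega> v)" for e
      by (rule edge_boundary_cluster_closed[OF that])
  qed (rule fin)
  then obtain S where S: "P S" and least: "\<And>T. P T \<Longrightarrow> card (edge_boundary V E S) \<le> card (edge_boundary V E T)"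
    using ex_has_least_nat[of P _ "\<lambda>S. card (edge_boundary V E S)"] by blast
  have S': "S \<subseteq> V" "finite S" "v \<in> S" "\<And>e. e \<in> edge_boundary V E S \<Longrightarrow> \<not> \<omega> e"
    using S unfolding P_def by auto
  have fS: "finite (edge_boundary V E S)" using boundary_finite_nonempty(1)[OF S'(1,2)] S'(3) by blast
  have "edge_boundary V E T = edge_boundary V E S"
    if T: "T \<subseteq> V" "finite T" "T \<noteq> {}" "edge_boundary V E T \<subseteq> edge_boundary V E S" for T
  proof (rule ccontr)
    assume "edge_boundary V E T \<noteq> edge_boundary V E S"
    then have ps: "edge_boundary V E T \<subset> edge_boundary V E S" using T(4) by blast
    show False
    proof (cases "v \<in> T")
      case True
      then have "P T" unfolding P_def using T S'(4) by blast
      then show False using least[of T] psubset_card_mono[OF fS ps] by simp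
    next
      case False
      have eq: "edge_boundary V E (sym_diff S T) = edge_boundary V E S - edge_boundary V E T"
        using edge_boundary_sym_diff[OF G S'(1) T(1)] T(4) by blast
      have "P (sym_diff S T)" unfolding P_def eq using False S' T by auto
      moreover have "edge_boundary V E S - edge_boundary V E T \<subset> edge_boundary V E S"
        using boundary_finite_nonempty(2)[OF T(1-3)] T(4) by blast
      ultimately show False
        using least[of "sym_diff S T"] psubset_card_mono[OF fS] unfolding eq by (meson leD)
    qed
  qed
  then have "bond v (edge_boundary V E S)" unfolding bond_def using S' by blast
  then show ?thesis using S'(4) by blast
qed

text \<open>The Peierls argument: with \<open>p\<close> so close to 1 that \<open>L * (1 - p) \<le> 1/3\<close>, the expected number of
  closed bonds around \<open>v\<close> is at most \<open>1/3 + 1/9 + \<dots> = 1/2\<close>.\<close>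

lemma infinite_cluster_likely:
  assumes "V \<noteq> {}"
  shows "\<exists>p0<1. 0 \<le> p0 \<and> (\<forall>p. p0 < p \<and> p \<le> 1 \<longrightarrow>
    measure (percolation E p) (infinite_cluster_event V E) \<noteq> 0)"
proof -
  obtain v where v: "v \<in> V" using assms by blast
  obtain L :: nat where L: "\<And>m. m \<ge> 1 \<Longrightarrow> finite {F. bond v F \<and> card F = m} \<and> card {F. bond v F \<and> card F = m} \<le> L ^ m"
    using card_bonds_le v by blast
  define p0 where "p0 = 1 - 1 / (3 * (real L + 1))"
  have p0: "0 \<le> p0" "p0 < 1" unfolding p0_def by (auto simp: field_simps)
  have "measure (percolation E p) (infinite_cluster_event V E) \<noteq> 0" if p: "p0 < p" "p \<le> 1" for p
  proof -
    let ?M = "percolation E p"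
    interpret prob_space ?M by (rule prob_space_percolation)
    have p01: "0 \<le> p" "p \<le> 1" using p p0 by auto
    \<comment> \<open>the event that some bond of size \<open>m + 1\<close> around \<open>v\<close> is closed\<close>
    define A where "A m = (\<Union>F\<in>{F. bond v F \<and> card F = Suc m}. {\<omega> \<in> space ?M. \<forall>e\<in>F. \<not> \<omega> e})" for m
    have FE: "F \<subseteq> E" "finite F" if "bond v F" for F
    proof -
      obtain S where S: "S \<subseteq> V" "finite S" "v \<in> S" "F = edge_boundary V E S"
        using \<open>bond v F\<close> unfolding bond_def by blast
      show "F \<subseteq> E" unfolding S(4) by (rule edge_boundary_subset)
      show "finite F" unfolding S(4) using boundary_finite_nonempty(1)[OF S(1,2)] S(3) by blast
    qed
    have ev: "{\<omega> \<in> space ?M. \<forall>e\<in>F. \<not> \<omega> e} \<in> sets ?M" if "bond v F" for F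
    proof -
      have "Measurable.pred ?M (\<lambda>\<omega>. \<forall>e\<in>F. \<not> \<omega> e)"
        using FE[OF that] sets_percolation_coordinate
        by (intro pred_intros_finite pred_intros_logic) auto
      then show ?thesis by (simp add: pred_def)
    qed
    have Aev: "A m \<in> sets ?M" for m
      unfolding A_def using L[of "Suc m"] ev by (intro sets.finite_UN) auto
    have pA: "measure ?M (A m) \<le> (1 / 3) ^ Suc m" for m
    proof -
      let ?F = "{F. bond v F \<and> card F = Suc m}"
      have cL: "real (card ?F) \<le> real (L ^ Suc m)"
        using L[of "Suc m"] by (simp only: of_nat_le_iff)
      have "measure ?M (A m) \<le> (\<Sum>F\<in>?F. measure ?M {\<omega> \<in> space ?M. \<forall>e\<in>F. \<not> \<omega> e})"
        unfolding A_def using L[of "Suc m"] ev by (intro finite_measure_subadditive_finite) auto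
      also have "\<dots> = (\<Sum>F\<in>?F. (1 - p) ^ Suc m)"
      proof (intro sum.cong refl)
        fix F assume F: "F \<in> ?F"
        then show "measure ?M {\<omega> \<in> space ?M. \<forall>e\<in>F. \<not> \<omega> e} = (1 - p) ^ Suc m"
          using prob_all_closed[of F E p] FE[of F] p01 by auto
      qed
      also have "\<dots> = real (card ?F) * (1 - p) ^ Suc m" by simp
      also have "\<dots> \<le> real (L ^ Suc m) * (1 - p) ^ Suc m"
        by (rule mult_right_mono[OF cL]) (use p01 in simp)
      also have "\<dots> = (real L * (1 - p)) ^ Suc m" by (simp only: of_nat_power power_mult_distrib)
      also have "\<dots> \<le> (1 / 3) ^ Suc m"
      proof (rule power_mono)
        have "1 - p \<le> 1 / (3 * (real L + 1))" using p unfolding p0_def by simp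
        then have "real L * (1 - p) \<le> real L * (1 / (3 * (real L + 1)))" by (rule mult_left_mono) simp
        also have "\<dots> \<le> 1 / 3" by (simp add: field_simps)
        finally show "real L * (1 - p) \<le> 1 / 3" .
        show "0 \<le> real L * (1 - p)" using p01 by simp
      qed
      finally show ?thesis .
    qed
    have geo: "(\<lambda>m. (1 / 3 :: real) ^ Suc m) sums (1 / 2)"
      using sums_mult[OF geometric_sums[of "1 / 3 :: real"], of "1 / 3"] by simp
    have sumA: "summable (\<lambda>m. measure ?M (A m))"
      by (rule summable_comparison_test'[OF sums_summable[OF geo], of 0]) (use pA in simp)
    have "measure ?M (\<Union>m. A m) \<le> (\<Sum>m. measure ?M (A m))"
      using Aev sumA by (intro finite_measure_subadditive_countably) auto
    also have "\<dots> \<le> (\<Sum>m. (1 / 3) ^ Suc m)" by (rule suminf_le[OF pA sumA sums_summable[OF geo]])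
    also have "\<dots> = 1 / 2" using geo by (rule sums_unique[symmetric])
    finally have half: "measure ?M (\<Union>m. A m) \<le> 1 / 2" .
    have "space ?M - (\<Union>m. A m) \<subseteq> infinite_cluster_event V E"
    proof
      fix \<omega> assume w: "\<omega> \<in> space ?M - (\<Union>m. A m)"
      have "infinite (cluster V E \<omega> v)"
      proof
        assume "finite (cluster V E \<omega> v)"
        then obtain F where F: "bond v F" "\<forall>e\<in>F. \<not> \<omega> e"
          using closed_bond_around_finite_cluster[OF v] by blast
        have "F \<noteq> {}" by (rule bond_nearby(2)[OF F(1) refl])
        then obtain m where "card F = Suc m" using FE(2)[OF F(1)] by (metis card_eq_0_iff not0_implies_Suc)
        then have "\<omega> \<in> A m" using F w unfolding A_def by blast
        then show False using w by blast
      qed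
      then show "\<omega> \<in> infinite_cluster_event V E"
        using w v unfolding infinite_cluster_event_def space_percolation by blast
    qed
    then have "measure ?M (space ?M - (\<Union>m. A m)) \<le> measure ?M (infinite_cluster_event V E)"
      using infinite_cluster_event_measurable by (rule finite_measure_mono)
    moreover have "measure ?M (space ?M - (\<Union>m. A m)) = 1 - measure ?M (\<Union>m. A m)"
      using Aev by (intro prob_compl) auto
    ultimately show ?thesis using half by simp
  qed
  then show ?thesis using p0 by blast
qed

text \<open>Needed because the supremum that defines the critical value is only meaningful for a nonempty
  set.\<close>

lemma no_infinite_cluster_at_zero:
  "measure (percolation E 0) (infinite_cluster_event V E) = 0"
proof -
  let ?M = "percolation E 0"
  interpret prob_space ?M by (rule prob_space_percolation)
  have "AE \<omega> in ?M. \<not> \<omega> e" if e: "e \<in> E" for e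
  proof -
    have "{\<omega> \<in> space ?M. \<not> \<omega> e} \<in> sets ?M"
      using pred_intros_logic(2)[OF sets_percolation_coordinate[OF e, of 0]] by (simp add: pred_def)
    moreover have "measure ?M {\<omega> \<in> space ?M. \<not> \<omega> e} = 1"
      using prob_all_closed[of "{e}" E 0] e by simp
    ultimately show ?thesis using prob_Collect_eq_1[of "\<lambda>\<omega>. \<not> \<omega> e"] by simp
  qed
  then have "AE \<omega> in ?M. \<forall>e\<in>E. \<not> \<omega> e" 
    by (intro iffD2[OF AE_ball_countable[OF countable_edges]] ballI)
  then have "AE \<omega> in ?M. \<omega> \<notin> infinite_cluster_event V E"
  proof (rule AE_mp, intro AE_I2 impI)
    fix \<omega> assume "\<forall>e\<in>E. \<not> \<omega> e"
    then have "adj (open_edges E \<omega>) = {}" unfolding adj_def open_edges_def by auto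
    then have "cluster V E \<omega> v \<subseteq> {v}" for v unfolding cluster_def by auto
    then have "finite (cluster V E \<omega> v)" for v by (rule finite_subset) simp
    then show "\<omega> \<notin> infinite_cluster_event V E" unfolding infinite_cluster_event_def by blast
  qed
  then show ?thesis using prob_eq_0[OF infinite_cluster_event_measurable] by simp
qed

end

theorem mainTheorem1:
  fixes V :: "'a set" and E :: "'a set set"
  assumes "simple_graph V E" and "V \<noteq> {}"
    and "planar V E"
    and "\<exists>\<phi> \<gamma>. plane_representation V E \<phi> \<gamma> \<and> (\<forall>x. \<not> vertex_accumulation_point V \<phi> x)"
    and "\<exists>K D :: real. \<forall>v\<in>V. \<forall>r::real. r \<ge> 1 \<longrightarrow>
           finite (graph_ball V E v r) \<and> real (card (graph_ball V E v r)) \<le> K * r powr D"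
    and "\<exists>k \<epsilon> :: real. k > 0 \<and> \<epsilon> > 0 \<and>
           (\<forall>S. S \<subseteq> V \<and> finite S \<and> S \<noteq> {} \<longrightarrow>
             real (card (edge_boundary V E S)) \<ge> k * real (card S) powr \<epsilon>)"
  shows "critical_prob V E < 1"
proof -
  obtain \<phi> \<gamma> where rep: "plane_representation V E \<phi> \<gamma>" "\<And>x. \<not> vertex_accumulation_point V \<phi> x"
    using assms(4) by blast
  obtain K D :: real where KD: "\<forall>v\<in>V. \<forall>r::real. r \<ge> 1 \<longrightarrow>
      finite (graph_ball V E v r) \<and> real (card (graph_ball V E v r)) \<le> K * r powr D"
    using assms(5) by blast
  obtain k \<epsilon> :: real where k\<epsilon>: "k > 0" "\<epsilon> > 0" "\<forall>S. S \<subseteq> V \<and> finite S \<and> S \<noteq> {} \<longrightarrow>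
      real (card (edge_boundary V E S)) \<ge> k * real (card S) powr \<epsilon>"
    using assms(6) by blast
  interpret isoperimetric_plane_graph V E \<phi> \<gamma> K D k \<epsilon>
    using assms(1) rep KD k\<epsilon> by unfold_locales auto
  obtain p0 where p0: "p0 < 1" "0 \<le> p0"
    "\<And>p. p0 < p \<Longrightarrow> p \<le> 1 \<Longrightarrow> measure (percolation E p) (infinite_cluster_event V E) \<noteq> 0"
    using infinite_cluster_likely[OF assms(2)] by blast
  have "critical_prob V E \<le> p0" unfolding critical_prob_def
  proof (rule cSup_least)
    show "{p \<in> {0..1}. measure (percolation E p) (infinite_cluster_event V E) = 0} \<noteq> {}"
      using no_infinite_cluster_at_zero by force
    show "p \<le> p0" if "p \<in> {p \<in> {0..1}. measure (percolation E p) (infinite_cluster_event V E) = 0}" for p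
      using that p0(3)[of p] by force
  qed
  then show ?thesis using p0(1) by linarith
qed

end
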